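(* Let $G$ be a graph with the canonical labeling and trivial multiplicity (the classical case). 0) $\operatorname{Aff}(S_n)$ is a point for each $n\in\mathbb{N}$, $n\ge1$. 1) For every multiplicity map $\sigma$ of $G$ (keeping the canonical labeling), $\operatorname{Aff}(G)\cong\operatorname{Aff}(G,\sigma)$ and $I_G=I_{(G,\sigma)}$. Now let $G=(G,l,A,\sigma)$ and $H=(H,i,B,\rho)$ be labelled graphs with multiplicity. 2) $\operatorname{Aff}(G\sqcup H)\cong\operatorname{Aff}(G\#_0H)$. 3) $\phi_{G\sqcup H}=\phi_G\phi_H$, i.e. $\phi_{G\sqcup H}(r_{a\times b})=\phi_G(r_a)\,\phi_H(r_b)$ for every partition $a$ of $V_G$ and every partition $b$ of $V_H$. 4) For every $n\geq 1$, $\operatorname{Aff}(G\sqcup S_n)\cong\operatorname{Aff}(G)$ and $I_{G\sqcup S_n}=I_G'+J$, where $J$ is an ideal generated only by linear relations (linear forms in the variables), and $I_G'$ is the ideal generated by the polynomials obtained from the elements of $I_G$ by replacing each variable $r_{A|B}$ with $r_{A|B\cup V_{S_n}}$. 5) An arbitrary binomial (difference of two monomials) lies in $I_{G\sqcup H}$ if and only if either it is linear of the form $r_{a\times b}-r_{a\times b^*}$ with $a$ a partition of $V_G$ and $b$ a partition of $V_H$, or it is non-linear of the form $$r_{a_1\times b_1}\cdots r_{a_h\times b_h}-r_{a_{h+1}\times b_{h+1}}\cdots r_{a_{2h}\times b_{2h}},$$ where $a_1,\dots,a_{2h}$ are partitions of $V_G$ and $b_1,\dots,b_{2h}$ are partitions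 of $V_H$ with $$r_{a_1}\cdots r_{a_h}-r_{a_{h+1}}\cdots r_{a_{2h}}\in I_{(G,l,A,\sigma)}\quad\text{and}\quad r_{b_1}\cdots r_{b_h}-r_{b_{h+1}}\cdots r_{b_{2h}}\in I_{(H,i,B,\rho)}.$$
   Context: Graphs are finite and simple with nonempty vertex set, $G=(V_G;E_G)$; $\mathbb{K}$ is a field. $S_n$ is the graph with $n$ isolated vertices and no edges. Partitions. For a finite nonempty set $V$, $\Pi_V$ is the set of unordered pairs $A|B$ with $A\cup B=V$, $A\cap B=\emptyset$ (one of $A,B$ may be empty; $A|B=B|A$). $Cut_G(A|B)$ is the set of edges of $G$ with one endpoint in $A$ and the other in $B$. $R_G=\mathbb{K}[r_{p}:p\in\Pi_{V_G}]$. "Partition" always means element of such a $\Pi_V$. Labelled graphs with multiplicity. A labeling is a surjective map $l:E_G\to A$ onto a set $A$ of labels; the canonical labeling is $\{i,j\}\mapsto(i,j)$ (a bijection). A multiplicity map is a map $\sigma:E_G\to\mathbb{Z}\setminus\{0\}$; it is trivial if $\sigma\equiv1$. Then $(G,l,A,\sigma)$ is a labelled graph with multiplicity. The notation $I_G$, $\operatorname{Aff}(G)$ for $G$ in the classical case uses the canonical labeling and trivial multiplicity; $(G,\sigma)$ means $G$ with canonical labeling and multiplicity $\sigma$. Cut ideal and cut variety. Let $T_A=\mathbb{K}[s_a^{\pm1},t_a^{\pm1}:a\in A]$ and let $\phi_{(G,l,A,\sigma)}:R_G\to T_A$ be the $\mathbb{K}$-algebra homomorphism $$r_{p}\mapsto\prod_{e\in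 Cut_G(p)}s_{l(e)}^{\sigma(e)}\prod_{e\in E_G\setminus Cut_G(p)}t_{l(e)}^{\sigma(e)}.$$ The cut ideal $I_{(G,l,A,\sigma)}$ is $\ker\phi_{(G,l,A,\sigma)}$, and the affine cut variety $\operatorname{Aff}(G,l,A,\sigma)$ is the affine variety with coordinate ring $R_G/I_{(G,l,A,\sigma)}$. When the labeling and multiplicity are understood we write $\phi_G,I_G,\operatorname{Aff}(G)$. Operations. The disjoint union is $(G,l,A,\sigma)\sqcup(H,i,B,\rho)=(G\sqcup H,(l,i),A\sqcup B,(\sigma,\rho))$, with disjoint label sets. The clique $0$-sum $G\#_0H$ is the labelled graph with multiplicity obtained from $G\sqcup H$ by identifying one vertex of $G$ with one vertex of $H$ (any choice), edges keeping their labels (in $A\sqcup B$) and multiplicities. Product partitions. Given partitions $a=A|B$ of $V_G$ and $b=C|D$ of $V_H$ written with a chosen order of their parts, $b^*=D|C$, $a\times b=(A\cup C)|(B\cup D)$ and $a\times b^*=(A\cup D)|(B\cup C)$; every partition of $V_G\sqcup V_H$ is of this form. In part 5 the order of the parts in each $a_j$, $b_j$ may be chosen arbitrarily. In part 4, for each partition of $V_G$ one order $A|B$ of its parts is fixed in defining the replacement.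
   Formalization: In part 5 the second family is taken for all h ≥ 1 ("non-linear" is dropped, as it fails e.g. for S_2 ⊔ an edge); if every label has total multiplicity 0 (e.g. no edges), the two monomials may have different numbers h, k of factors, since then r_p − 1 can lie in the ideal. *)

theory Defs
  imports "HOL-Algebra.QuotRing" "HOL-Algebra.Module" "HOL-Library.Poly_Mapping"
begin

section \<open>Labelled graphs with multiplicity\<close>

record ('v, 'l) lmgraph =
  verts :: "'v set"
  edges :: "'v set set"
  lab :: "'v set \<Rightarrow> 'l"
  labels :: "'l set"
  multip :: "'v set \<Rightarrow> int"

definition simple_graph :: "'v set \<Rightarrow> 'v set set \<Rightarrow> bool" where
  "simple_graph V E \<longleftrightarrow> finite V \<and> V \<noteq> {} \<and> (\<forall>e\<in>E. e \<subseteq> V \<and> card e = 2)"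

definition multiplicity_map :: "'v set set \<Rightarrow> ('v set \<Rightarrow> int) \<Rightarrow> bool" where
  "multiplicity_map E \<sigma> \<longleftrightarrow> (\<forall>e\<in>E. \<sigma> e \<noteq> 0)"

definition labelled_multigraph :: "('v, 'l) lmgraph \<Rightarrow> bool" where
  "labelled_multigraph G \<longleftrightarrow>
     simple_graph (verts G) (edges G) \<and> lab G ` edges G = labels G \<and>
     multiplicity_map (edges G) (multip G)"

text \<open>The canonical labeling is bijective; the label of the edge \<open>{i, j}\<close> is taken to be
  the edge itself.\<close>

definition canonical :: "'v set \<Rightarrow> 'v set set \<Rightarrow> ('v set \<Rightarrow> int) \<Rightarrow> ('v, 'v set) lmgraph" where
  "canonical V E \<sigma> = \<lparr>verts = V, edges = E, lab = (\<lambda>e. e), labels = E, multip = \<sigma>\<rparr>"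

definition classical :: "'v set \<Rightarrow> 'v set set \<Rightarrow> ('v, 'v set) lmgraph" where
  "classical V E = canonical V E (\<lambda>_. 1)"

definition isolated :: "nat \<Rightarrow> (nat, nat set) lmgraph" where
  "isolated n = classical {1..n} {}"

definition disjoint_union ::
    "('v, 'l) lmgraph \<Rightarrow> ('w, 'm) lmgraph \<Rightarrow> ('v + 'w, 'l + 'm) lmgraph" where
  "disjoint_union G H =
     \<lparr>verts = verts G <+> verts H,
      edges = (`) Inl ` edges G \<union> (`) Inr ` edges H,
      lab = (\<lambda>e. if e \<subseteq> range Inl then Inl (lab G (Inl -` e)) else Inr (lab H (Inr -` e))),
      labels = labels G <+> labels H,
      multip = (\<lambda>e. if e \<subseteq> range Inl then multip G (Inl -` e) else multip H (Inr -` e))\<rparr>"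

text \<open>The identification of the vertex \<open>y\<close> of the second graph with the vertex \<open>x\<close> of the
  first. The induced map on the edges of the disjoint union is injective, so that every edge of
  the \<open>0\<close>-sum inherits label and multiplicity from a unique edge.\<close>

definition glue :: "'v \<Rightarrow> 'w \<Rightarrow> 'v + 'w \<Rightarrow> 'v + 'w" where
  "glue x y u = (if u = Inr y then Inl x else u)"

definition zero_sum ::
    "'v \<Rightarrow> 'w \<Rightarrow> ('v, 'l) lmgraph \<Rightarrow> ('w, 'm) lmgraph \<Rightarrow> ('v + 'w, 'l + 'm) lmgraph" where
  "zero_sum x y G H =
     (let D = disjoint_union G H;
          lift = inv_into (edges D) ((`) (glue x y))
      in \<lparr>verts = glue x y ` verts D,
          edges = (`) (glue x y) ` edges D,
          lab = (\<lambda>e. lab D (lift e)),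
          labels = labels D,
          multip = (\<lambda>e. multip D (lift e))\<rparr>)"

text \<open>If \<open>d\<close> is the total multiplicity of the label \<open>c\<close>, then in the image of a monomial of
  degree \<open>h\<close> under \<open>cut_map\<close> the exponents of \<open>S c\<close> and \<open>T c\<close> add up to \<open>h * d\<close>. Hence the
  cut ideal is homogeneous as soon as some label has nonzero total multiplicity, for instance in
  the classical case with at least one edge. If all totals vanish, the variable of the partition
  into the whole vertex set and the empty set is mapped to \<open>1\<close>, and the cut ideal is not
  homogeneous.\<close>

definition label_total :: "('v, 'l) lmgraph \<Rightarrow> 'l \<Rightarrow> int" where
  "label_total G c = (\<Sum>e\<in>{e \<in> edges G. lab G e = c}. multip G e)"


section \<open>Partitions\<close>

text \<open>\<open>ordered_partitions V\<close> contains the pairs \<open>(A, B)\<close> that write \<open>A|B\<close> with a chosen order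
  of the parts; \<open>A|B\<close> itself is the set \<open>{A, B}\<close>.\<close>

definition ordered_partitions :: "'v set \<Rightarrow> ('v set \<times> 'v set) set" where
  "ordered_partitions V = {(A, B). A \<union> B = V \<and> A \<inter> B = {}}"

definition unordered :: "'v set \<times> 'v set \<Rightarrow> 'v set set" where
  "unordered a = {fst a, snd a}"

definition partitions :: "'v set \<Rightarrow> 'v set set set" where
  "partitions V = unordered ` ordered_partitions V"

definition cut :: "('v, 'l) lmgraph \<Rightarrow> 'v set set \<Rightarrow> 'v set set" where
  "cut G p = {e \<in> edges G. \<exists>A B x y. p = {A, B} \<and> x \<in> A \<and> y \<in> B \<and> e = {x, y}}"

definition part_prod ::
    "'v set \<times> 'v set \<Rightarrow> 'w set \<times> 'w set \<Rightarrow> ('v + 'w) set set" where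
  "part_prod a b = {Inl ` fst a \<union> Inr ` fst b, Inl ` snd a \<union> Inr ` snd b}"


section \<open>Polynomial and Laurent polynomial rings\<close>

text \<open>A (Laurent) polynomial is a finitely supported function from exponent vectors to
  coefficients, with convolution as product; exponents are natural numbers for
  polynomials and integers for Laurent polynomials.\<close>

datatype 'l tvar = S 'l | T 'l

type_synonym ('x, 'k) polyn = "('x \<Rightarrow>\<^sub>0 nat) \<Rightarrow>\<^sub>0 'k"
type_synonym ('v, 'k) cut_poly = "('v set set, 'k) polyn"
type_synonym ('l, 'k) laurent = "('l tvar \<Rightarrow>\<^sub>0 int) \<Rightarrow>\<^sub>0 'k"

definition const :: "'k \<Rightarrow> 'm::zero \<Rightarrow>\<^sub>0 'k::zero" where
  "const c = Poly_Mapping.single 0 c"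

definition monomial :: "'m \<Rightarrow> 'm \<Rightarrow>\<^sub>0 'k::zero_neq_one" where
  "monomial u = Poly_Mapping.single u 1"

definition var :: "'x \<Rightarrow> ('x, 'k::zero_neq_one) polyn" where
  "var x = monomial (Poly_Mapping.single x 1)"

definition tvar_power :: "'l tvar \<Rightarrow> int \<Rightarrow> ('l, 'k::zero_neq_one) laurent" where
  "tvar_power x k = monomial (Poly_Mapping.single x k)"

text \<open>All (Laurent) polynomials involving only the variables in \<open>X\<close>.\<close>

definition poly_ring :: "'x set \<Rightarrow> (('x \<Rightarrow>\<^sub>0 'e::comm_monoid_add) \<Rightarrow>\<^sub>0 'k::comm_ring_1) ring" where
  "poly_ring X =
     \<lparr>carrier = {f. \<forall>m\<in>Poly_Mapping.keys f. Poly_Mapping.keys m \<subseteq> X},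
      mult = (*), one = 1, zero = 0, add = (+)\<rparr>"

text \<open>The algebra homomorphism that sends each variable \<open>x\<close> to \<open>g x\<close>.\<close>

definition subst_hom ::
    "('x \<Rightarrow> 'm::comm_monoid_add \<Rightarrow>\<^sub>0 'k::comm_ring_1) \<Rightarrow> ('x, 'k) polyn \<Rightarrow> 'm \<Rightarrow>\<^sub>0 'k" where
  "subst_hom g f =
     (\<Sum>m\<in>Poly_Mapping.keys f. const (Poly_Mapping.lookup f m) *
        (\<Prod>x\<in>Poly_Mapping.keys m. g x ^ Poly_Mapping.lookup m x))"

text \<open>The map of Laurent polynomial rings induced by a map of labels.\<close>

definition relabel :: "('l \<Rightarrow> 'm) \<Rightarrow> ('l, 'k::comm_ring_1) laurent \<Rightarrow> ('m, 'k) laurent" where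
  "relabel j f =
     (\<Sum>m\<in>Poly_Mapping.keys f.
        Poly_Mapping.single
          (\<Sum>x\<in>Poly_Mapping.keys m. Poly_Mapping.single (map_tvar j x) (Poly_Mapping.lookup m x))
          (Poly_Mapping.lookup f m))"

definition linear_form :: "('x, 'k::zero) polyn \<Rightarrow> bool" where
  "linear_form f \<longleftrightarrow> (\<forall>m\<in>Poly_Mapping.keys f. \<exists>x. m = Poly_Mapping.single x 1)"

definition binomials :: "'x set \<Rightarrow> ('x, 'k::comm_ring_1) polyn set" where
  "binomials X = {monomial u - monomial v |u v.
     Poly_Mapping.keys u \<subseteq> X \<and> Poly_Mapping.keys v \<subseteq> X}"


section \<open>Cut ideals and cut varieties\<close>

definition cut_ring :: "('v, 'l) lmgraph \<Rightarrow> ('v, 'k::field) cut_poly ring" where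
  "cut_ring G = poly_ring (partitions (verts G))"

definition torus_ring :: "('v, 'l) lmgraph \<Rightarrow> ('l, 'k::field) laurent ring" where
  "torus_ring G = poly_ring (S ` labels G \<union> T ` labels G)"

definition cut_map :: "('v, 'l) lmgraph \<Rightarrow> ('v, 'k::field) cut_poly \<Rightarrow> ('l, 'k) laurent" where
  "cut_map G = subst_hom (\<lambda>p.
     (\<Prod>e\<in>cut G p. tvar_power (S (lab G e)) (multip G e)) *
     (\<Prod>e\<in>edges G - cut G p. tvar_power (T (lab G e)) (multip G e)))"

definition cut_ideal :: "('v, 'l) lmgraph \<Rightarrow> ('v, 'k::field) cut_poly set" where
  "cut_ideal G = a_kernel (cut_ring G) (torus_ring G :: ('l, 'k) laurent ring) (cut_map G)"

text \<open>An affine variety over the field is given by its coordinate ring, as an algebra over the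
  field; isomorphisms of affine varieties are isomorphisms of these algebras, and a point is the
  variety whose coordinate ring is the field itself.\<close>

definition Aff :: "('v, 'l) lmgraph \<Rightarrow> ('k::field, ('v, 'k) cut_poly set) module" where
  "Aff G =
     (let R = cut_ring G; I = cut_ideal G; Q = R Quot I
      in ring.extend Q
           (module.fields (\<lambda>c X. (I +>\<^bsub>R\<^esub> const c) \<otimes>\<^bsub>Q\<^esub> X)))"

definition point :: "('k::field, 'k) module" where
  "point = \<lparr>carrier = UNIV, mult = (*), one = 1, zero = 0, add = (+), smult = (*)\<rparr>"

definition aff_iso :: "('k, 'a) module \<Rightarrow> ('k, 'b) module \<Rightarrow> bool" (infix \<open>\<cong>\<^sub>a\<close> 50) where
  "X \<cong>\<^sub>a Y \<longleftrightarrow>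
     (\<exists>h\<in>ring_iso X Y. \<forall>c. \<forall>f\<in>carrier X. h (c \<odot>\<^bsub>X\<^esub> f) = c \<odot>\<^bsub>Y\<^esub> h f)"

text \<open>For a chosen order \<open>ord p = (A, B)\<close> of the parts of each partition \<open>p\<close>: the replacement of
  \<open>A|B\<close> by \<open>A|(B \<union> W)\<close>, where \<open>W\<close> is the vertex set of the second graph.\<close>

definition extend_vars ::
    "('v set set \<Rightarrow> 'v set \<times> 'v set) \<Rightarrow> 'w set \<Rightarrow>
     ('v, 'k::field) cut_poly \<Rightarrow> ('v + 'w, 'k) cut_poly" where
  "extend_vars ord W = subst_hom (\<lambda>p. var (part_prod (ord p) ({}, W)))"

text \<open>The binomials with \<open>h\<close> factors in the first and \<open>k\<close> factors in the second monomial that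
  arise from pairs of binomials in the two cut ideals.\<close>

definition product_binomial ::
    "('v, 'l) lmgraph \<Rightarrow> ('w, 'm) lmgraph \<Rightarrow> nat \<Rightarrow> nat \<Rightarrow> ('v + 'w, 'k::field) cut_poly \<Rightarrow> bool" where
  "product_binomial G H h k f \<longleftrightarrow>
     (\<exists>a b. (\<forall>j\<in>{1..h + k}. a j \<in> ordered_partitions (verts G) \<and> b j \<in> ordered_partitions (verts H)) \<and>
        f = (\<Prod>j\<in>{1..h}. var (part_prod (a j) (b j))) -
            (\<Prod>j\<in>{h + 1..h + k}. var (part_prod (a j) (b j))) \<and>
        (\<Prod>j\<in>{1..h}. var (unordered (a j))) - (\<Prod>j\<in>{h + 1..h + k}. var (unordered (a j)))
          \<in> (cut_ideal G :: ('v, 'k) cut_poly set) \<and>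
        (\<Prod>j\<in>{1..h}. var (unordered (b j))) - (\<Prod>j\<in>{h + 1..h + k}. var (unordered (b j)))
          \<in> (cut_ideal H :: ('w, 'k) cut_poly set))"

definition swap_binomial ::
    "('v, 'l) lmgraph \<Rightarrow> ('w, 'm) lmgraph \<Rightarrow> ('v + 'w, 'k::field) cut_poly \<Rightarrow> bool" where
  "swap_binomial G H f \<longleftrightarrow>
     (\<exists>a\<in>ordered_partitions (verts G). \<exists>b\<in>ordered_partitions (verts H).
        f = var (part_prod a b) - var (part_prod a (prod.swap b)))"

end

theory Submission
  imports Defs "HOL.Modules"
begin

text \<open>The variable of a partition is mapped to a Laurent monomial, so the cut ideal is the toric
  ideal of the exponent vectors of the cuts, and the coordinate ring of the cut variety is the
  algebra of the monoid that these vectors generate. Hence the ideal depends on the vectors only up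
  to an injective additive map, and the variety only on the set of vectors. Multiplicities rescale
  the coordinates of the vectors by nonzero factors. The vector of \<open>a \<times> b\<close> in a disjoint union is
  the pair of the vectors of \<open>a\<close> and \<open>b\<close>: so \<open>a \<times> b\<close> and \<open>a \<times> b\<^sup>*\<close> have the same vector, isolated
  vertices contribute nothing, and a binomial lies in the ideal of a disjoint union iff both of its
  projections lie in the ideals of the two graphs.\<close>

abbreviation "keys \<equiv> Poly_Mapping.keys"
abbreviation "lookup \<equiv> Poly_Mapping.lookup"
abbreviation "single \<equiv> Poly_Mapping.single"

section \<open>Monoid algebras\<close>

lemma poly_mapping_induct [consumes 1, case_names zero single add]:
  fixes f :: "'m \<Rightarrow>\<^sub>0 'c::comm_monoid_add"
  assumes "keys f \<subseteq> M" and zero: "P 0"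
    and single: "\<And>m c. m \<in> M \<Longrightarrow> P (single m c)"
    and add: "\<And>f g. P f \<Longrightarrow> P g \<Longrightarrow> P (f + g)"
  shows "P f"
  using assms(1)
proof (induction f rule: update_induct)
  case const
  then show ?case by (simp add: zero)
next
  case (update f m c)
  have "Poly_Mapping.update m c f = f + single m c"
    using update.hyps(1)
    by (auto intro!: poly_mapping_eqI
        simp: lookup_update lookup_add lookup_single when_def in_keys_iff)
  moreover have "m \<in> M" "keys f \<subseteq> M"
    using update.prems update.hyps(2) by (auto simp: keys_update)
  ultimately show ?case by (simp add: update.IH single add)
qed

lemma const_add: "const (c + d) = const c + const d"
  by (simp add: const_def single_add)

lemma const_mult:
  "const (c * d :: 'k::comm_ring_1) = (const c * const d :: 'm::comm_monoid_add \<Rightarrow>\<^sub>0 'k)"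
  by (simp add: const_def mult_single)

lemma const_zero [simp]: "const 0 = 0"
  by (simp add: const_def)

lemma const_one [simp]: "const (1 :: 'k::comm_ring_1) = (1 :: 'm::comm_monoid_add \<Rightarrow>\<^sub>0 'k)"
  by (simp add: const_def)

lemma keys_const: "keys (const c) \<subseteq> {0}"
  by (simp add: const_def)

lemma monomial_zero [simp]: "monomial 0 = (1 :: 'm::comm_monoid_add \<Rightarrow>\<^sub>0 'k::comm_ring_1)"
  by (simp add: monomial_def)

lemma monomial_add:
  "monomial (m + n) = (monomial m * monomial n :: 'm::comm_monoid_add \<Rightarrow>\<^sub>0 'k::comm_ring_1)"
  by (simp add: monomial_def mult_single)

lemma monomial_sum:
  "monomial (\<Sum>j\<in>J. m j) = (\<Prod>j\<in>J. monomial (m j) :: 'm::comm_monoid_add \<Rightarrow>\<^sub>0 'k::comm_ring_1)"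
  by (induction J rule: infinite_finite_induct) (simp_all add: monomial_add)

lemma monomial_inject [simp]:
  "(monomial m :: 'm \<Rightarrow>\<^sub>0 'k::zero_neq_one) = monomial n \<longleftrightarrow> m = n"
  by (metis keys_single monomial_def singleton_inject zero_neq_one)

lemma single_eq_const_mult_monomial:
  "single m c = (const c * monomial m :: 'm::comm_monoid_add \<Rightarrow>\<^sub>0 'k::comm_ring_1)"
  by (simp add: const_def monomial_def mult_single)

definition linear_extension ::
    "('m \<Rightarrow> 'n \<Rightarrow>\<^sub>0 'k) \<Rightarrow> ('m \<Rightarrow>\<^sub>0 'k) \<Rightarrow> ('n::comm_monoid_add \<Rightarrow>\<^sub>0 'k::comm_ring_1)" where
  "linear_extension \<phi> f = (\<Sum>m\<in>keys f. const (lookup f m) * \<phi> m)"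

lemma linear_extension_zero [simp]: "linear_extension \<phi> 0 = 0"
  by (simp add: linear_extension_def)

lemma linear_extension_add [simp]:
  "linear_extension \<phi> (f + g) = linear_extension \<phi> f + linear_extension \<phi> g"
  unfolding linear_extension_def
  by (rule setsum_keys_plus_distrib) (simp_all add: const_add distrib_right)

lemma linear_extension_uminus [simp]: "linear_extension \<phi> (- f) = - linear_extension \<phi> f"
  by (metis add.right_inverse add_eq_0_iff linear_extension_add linear_extension_zero)

lemma linear_extension_diff [simp]:
  "linear_extension \<phi> (f - g) = linear_extension \<phi> f - linear_extension \<phi> g"
  by (simp flip: add_uminus_conv_diff)

lemma linear_extension_single: "linear_extension \<phi> (single m c) = const c * \<phi> m"
  by (cases "c = 0") (simp_all add: linear_extension_def)

lemma linear_extension_monomial [simp]: "linear_extension \<phi> (monomial m) = \<phi> m"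
  by (simp add: monomial_def linear_extension_single)

lemma linear_extension_const: "\<phi> 0 = 1 \<Longrightarrow> linear_extension \<phi> (const c) = const c"
  using linear_extension_single[of \<phi> 0 c] by (simp add: const_def)

lemma linear_extension_mult:
  assumes "\<And>m n. \<phi> (m + n) = \<phi> m * \<phi> n"
  shows "linear_extension \<phi> (f * g) = linear_extension \<phi> f * linear_extension \<phi> g"
proof (induction f rule: poly_mapping_induct[OF subset_UNIV])
  case (2 m c)
  show ?case
  proof (induction g rule: poly_mapping_induct[OF subset_UNIV])
    case (2 n d)
    show ?case
      by (simp add: mult_single linear_extension_single assms const_mult mult_ac)
  qed (simp_all add: distrib_left)
qed (simp_all add: distrib_right)

definition map_exponents ::
    "('m \<Rightarrow> 'n) \<Rightarrow> ('m \<Rightarrow>\<^sub>0 'k) \<Rightarrow> ('n::comm_monoid_add \<Rightarrow>\<^sub>0 'k::comm_ring_1)" where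
  "map_exponents h = linear_extension (\<lambda>m. monomial (h m))"

lemma map_exponents_monomial [simp]: "map_exponents h (monomial m) = monomial (h m)"
  by (simp add: map_exponents_def)

lemma map_exponents_eq_sum: "map_exponents h f = (\<Sum>m\<in>keys f. single (h m) (lookup f m))"
  by (simp add: map_exponents_def linear_extension_def single_eq_const_mult_monomial)

lemma lookup_map_exponents:
  assumes "inj h"
  shows "lookup (map_exponents h f) (h m) = lookup f m"
proof -
  have "lookup (map_exponents h f) (h m) = (\<Sum>n\<in>keys f. if n = m then lookup f n else 0)"
    using assms by (simp add: map_exponents_eq_sum lookup_sum lookup_single when_def inj_eq)
  then show ?thesis by (simp add: in_keys_iff)
qed

lemma map_exponents_eq_0_iff:
  assumes "inj h"
  shows "map_exponents h f = 0 \<longleftrightarrow> f = 0"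
proof
  assume "map_exponents h f = 0"
  then show "f = 0"
    using lookup_map_exponents[OF assms, of f] by (intro poly_mapping_eqI) simp
qed (simp add: map_exponents_def)

lemma cring_of_supported_functions:
  fixes R :: "('m::comm_monoid_add \<Rightarrow>\<^sub>0 'k::comm_ring_1, 'b) ring_scheme"
  assumes carrier: "carrier R = {f. keys f \<subseteq> M}" and zero: "0 \<in> M"
    and add: "\<And>m n. m \<in> M \<Longrightarrow> n \<in> M \<Longrightarrow> m + n \<in> M"
    and ops: "mult R = (*)" "one R = 1" "zero R = 0" "add R = (+)"
  shows "cring R"
proof -
  have add_closed: "f + g \<in> carrier R" if "f \<in> carrier R" "g \<in> carrier R" for f g
    using that keys_add[of f g] by (auto simp: carrier)
  have mult_closed: "f * g \<in> carrier R" if "f \<in> carrier R" "g \<in> carrier R" for f g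
    using that keys_mult[of f g] add by (fastforce simp: carrier)
  show ?thesis
  proof (intro cringI abelian_groupI comm_monoidI)
    fix f assume "f \<in> carrier R"
    then show "\<exists>g\<in>carrier R. g \<oplus>\<^bsub>R\<^esub> f = \<zero>\<^bsub>R\<^esub>"
      by (intro bexI[of _ "- f"]) (auto simp: ops carrier in_keys_iff)
  qed (simp_all add: ops add_closed mult_closed algebra_simps, simp_all add: carrier zero)
qed

definition monoid_algebra :: "'m::comm_monoid_add set \<Rightarrow> ('k::comm_ring_1, 'm \<Rightarrow>\<^sub>0 'k) module" where
  "monoid_algebra M =
     \<lparr>carrier = {f. keys f \<subseteq> M}, mult = (*), one = 1, zero = 0, add = (+),
      smult = (\<lambda>c f. const c * f)\<rparr>"

lemma monoid_algebra_simps [simp]: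
  "carrier (monoid_algebra M) = {f. keys f \<subseteq> M}"
  "mult (monoid_algebra M) = (*)" "one (monoid_algebra M) = 1"
  "zero (monoid_algebra M) = 0" "add (monoid_algebra M) = (+)"
  "smult (monoid_algebra M) = (\<lambda>c f. const c * f)"
  by (simp_all add: monoid_algebra_def)

inductive_set monoid_hull :: "'m::comm_monoid_add set \<Rightarrow> 'm set" for B where
  zero: "0 \<in> monoid_hull B"
| add: "b \<in> B \<Longrightarrow> m \<in> monoid_hull B \<Longrightarrow> b + m \<in> monoid_hull B"

lemma monoid_hull_incl: "b \<in> B \<Longrightarrow> b \<in> monoid_hull B"
  using monoid_hull.add[OF _ monoid_hull.zero] by force

lemma monoid_hull_add:
  "m \<in> monoid_hull B \<Longrightarrow> n \<in> monoid_hull B \<Longrightarrow> m + n \<in> monoid_hull B"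
  by (induction m rule: monoid_hull.induct) (simp_all add: add.assoc monoid_hull.add)

lemma monoid_hull_trivial:
  assumes "B \<subseteq> {0}"
  shows "monoid_hull B = {0}"
proof -
  have "m = 0" if "m \<in> monoid_hull B" for m
    using that assms by induction auto
  then show ?thesis using monoid_hull.zero by blast
qed

lemma cring_monoid_algebra: "cring (monoid_algebra (monoid_hull B))"
  by (rule cring_of_supported_functions[where M = "monoid_hull B"])
    (simp_all add: monoid_hull.zero monoid_hull_add)

section \<open>Polynomial rings and substitutions\<close>

lemma poly_ring_simps [simp]:
  "mult (poly_ring X) = (*)" "one (poly_ring X) = 1" "zero (poly_ring X) = 0"
  "add (poly_ring X) = (+)"
  by (simp_all add: poly_ring_def)

lemma carrier_poly_ring: "carrier (poly_ring X) = {f. keys f \<subseteq> {m. keys m \<subseteq> X}}"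
  by (auto simp: poly_ring_def)

lemma carrier_poly_ring_UNIV: "f \<in> carrier (poly_ring UNIV)"
  by (simp add: carrier_poly_ring)

lemma cring_poly_ring: "cring (poly_ring X)"
proof (rule cring_of_supported_functions[OF carrier_poly_ring])
  show "m + n \<in> {m. keys m \<subseteq> X}"
    if "m \<in> {m. keys m \<subseteq> X}" "n \<in> {m. keys m \<subseteq> X}" for m n :: "'a \<Rightarrow>\<^sub>0 'b"
    using that keys_add[of m n] by auto
qed simp_all

interpretation poly_ring: cring "poly_ring X" for X
  by (rule cring_poly_ring)

lemma const_in_poly_ring [simp]: "const c \<in> carrier (poly_ring X)"
  using keys_const[of c] by (auto simp: carrier_poly_ring)

lemma zero_in_poly_ring [simp]: "0 \<in> carrier (poly_ring X)"
  and one_in_poly_ring [simp]: "1 \<in> carrier (poly_ring X)"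
  using const_in_poly_ring[of 0 X] const_in_poly_ring[of 1 X] by simp_all

lemma monomial_in_poly_ring [simp]:
  "(monomial m :: _ \<Rightarrow>\<^sub>0 'k::comm_ring_1) \<in> carrier (poly_ring X) \<longleftrightarrow> keys m \<subseteq> X"
  by (simp add: carrier_poly_ring monomial_def)

lemma var_in_poly_ring [simp]:
  "(var x :: (_, 'k::comm_ring_1) polyn) \<in> carrier (poly_ring X) \<longleftrightarrow> x \<in> X"
  by (simp add: var_def)

lemma add_in_poly_ring [simp]:
  "f \<in> carrier (poly_ring X) \<Longrightarrow> g \<in> carrier (poly_ring X) \<Longrightarrow> f + g \<in> carrier (poly_ring X)"
  using poly_ring.a_closed[of f X g] by simp

lemma mult_in_poly_ring [simp]:
  "f \<in> carrier (poly_ring X) \<Longrightarrow> g \<in> carrier (poly_ring X) \<Longrightarrow> f * g \<in> carrier (poly_ring X)"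
  using poly_ring.m_closed[of f X g] by simp

lemma diff_in_poly_ring [simp]:
  assumes "f \<in> carrier (poly_ring X)" "g \<in> carrier (poly_ring X)"
  shows "f - g \<in> carrier (poly_ring X)"
proof -
  have "keys (f - g) \<subseteq> keys f \<union> keys g"
    by (auto simp: in_keys_iff lookup_minus)
  then show ?thesis using assms unfolding carrier_poly_ring by blast
qed

lemma prod_in_poly_ring:
  "(\<And>j. j \<in> J \<Longrightarrow> f j \<in> carrier (poly_ring X)) \<Longrightarrow> (\<Prod>j\<in>J. f j) \<in> carrier (poly_ring X)"
  by (induction J rule: infinite_finite_induct) simp_all

lemma var_power: "var x ^ n = (monomial (single x n) :: ('x, 'k::comm_ring_1) polyn)"
  by (induction n) (simp_all add: var_def flip: monomial_add single_add)

lemma poly_ring_induct [consumes 1, case_names const var add mult]: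
  fixes f :: "('x, 'k::comm_ring_1) polyn"
  assumes "f \<in> carrier (poly_ring X)"
    and const: "\<And>c. P (const c)" and var: "\<And>x. x \<in> X \<Longrightarrow> P (var x)"
    and add: "\<And>f g. f \<in> carrier (poly_ring X) \<Longrightarrow> g \<in> carrier (poly_ring X) \<Longrightarrow>
      P f \<Longrightarrow> P g \<Longrightarrow> P (f + g)"
    and mult: "\<And>f g. f \<in> carrier (poly_ring X) \<Longrightarrow> g \<in> carrier (poly_ring X) \<Longrightarrow>
      P f \<Longrightarrow> P g \<Longrightarrow> P (f * g)"
  shows "P f"
proof -
  let ?Q = "\<lambda>f. f \<in> carrier (poly_ring X) \<and> P f"
  have one: "?Q 1" using const[of 1] by simp
  have monomial: "?Q (monomial m)" if "keys m \<subseteq> X" for m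
    using that
  proof (induction m rule: poly_mapping_induct)
    case zero
    then show ?case using one by simp
  next
    case (single x n)
    have "?Q (var x ^ n)"
      by (induction n) (use one single var mult in auto)
    then show ?case by (simp add: var_power)
  next
    case (add m n)
    then show ?case using mult by (simp add: monomial_add)
  qed
  have "keys f \<subseteq> {m. keys m \<subseteq> X}" using assms(1) by (simp add: carrier_poly_ring)
  then have "?Q f"
  proof (induction f rule: poly_mapping_induct)
    case zero
    then show ?case using const[of 0] by simp
  next
    case (single m c)
    then show ?case
      using monomial mult const by (simp add: single_eq_const_mult_monomial)
  next
    case (add f g)
    then show ?case using assms(4) by simp
  qed
  then show ?thesis by simp
qed

definition eval_monom :: "('x \<Rightarrow> 'r) \<Rightarrow> ('x \<Rightarrow>\<^sub>0 nat) \<Rightarrow> 'r::comm_monoid_mult" where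
  "eval_monom g m = (\<Prod>x\<in>keys m. g x ^ lookup m x)"

lemma eval_monom_superset:
  assumes "finite K" "keys m \<subseteq> K"
  shows "eval_monom g m = (\<Prod>x\<in>K. g x ^ lookup m x)"
  unfolding eval_monom_def
  by (rule prod.mono_neutral_left) (use assms in \<open>auto simp: in_keys_iff\<close>)

lemma eval_monom_zero [simp]: "eval_monom g 0 = 1"
  by (simp add: eval_monom_def)

lemma eval_monom_add: "eval_monom g (m + n) = eval_monom g m * eval_monom g n"
proof -
  let ?K = "keys m \<union> keys n"
  have "eval_monom g (m + n) = (\<Prod>x\<in>?K. g x ^ lookup (m + n) x)"
    by (rule eval_monom_superset) (simp_all add: keys_add)
  also have "\<dots> = (\<Prod>x\<in>?K. g x ^ lookup m x) * (\<Prod>x\<in>?K. g x ^ lookup n x)"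
    by (simp add: lookup_add power_add prod.distrib)
  also have "\<dots> = eval_monom g m * eval_monom g n"
    by (subst (1 2) eval_monom_superset[of ?K]) simp_all
  finally show ?thesis .
qed

lemma subst_hom_eq_linear_extension: "subst_hom g = linear_extension (eval_monom g)"
  by (simp add: fun_eq_iff subst_hom_def linear_extension_def eval_monom_def)

lemma subst_hom_const [simp]: "subst_hom g (const c) = const c"
  by (simp add: subst_hom_eq_linear_extension linear_extension_const)

lemma subst_hom_zero [simp]: "subst_hom g 0 = 0"
  and subst_hom_add [simp]: "subst_hom g (f + h) = subst_hom g f + subst_hom g h"
  and subst_hom_diff [simp]: "subst_hom g (f - h) = subst_hom g f - subst_hom g h"
  by (simp_all add: subst_hom_eq_linear_extension)

lemma subst_hom_mult [simp]: "subst_hom g (f * h) = subst_hom g f * subst_hom g h"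
  by (simp add: subst_hom_eq_linear_extension linear_extension_mult eval_monom_add)

lemma subst_hom_one [simp]: "subst_hom g 1 = 1"
  by (simp flip: const_one)

lemma subst_hom_prod [simp]: "subst_hom g (\<Prod>j\<in>J. f j) = (\<Prod>j\<in>J. subst_hom g (f j))"
  by (induction J rule: infinite_finite_induct) simp_all

lemma subst_hom_var [simp]: "subst_hom g (var x) = g x"
  by (simp add: subst_hom_eq_linear_extension var_def) (simp add: eval_monom_def)

lemma subst_hom_in_poly_ring:
  assumes "f \<in> carrier (poly_ring X)" "\<And>x. x \<in> X \<Longrightarrow> g x \<in> carrier (poly_ring Y)"
  shows "subst_hom g f \<in> carrier (poly_ring Y)"
  using assms(1) by (induction rule: poly_ring_induct) (simp_all add: assms(2))

lemma subst_hom_cong: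
  assumes "f \<in> carrier (poly_ring X)" "\<And>x. x \<in> X \<Longrightarrow> g x = h x"
  shows "subst_hom g f = subst_hom h f"
  using assms(1) by (induction rule: poly_ring_induct) (simp_all add: assms(2))

lemma linear_extension_subst_hom:
  assumes "\<phi> 0 = 1" "\<And>m n. \<phi> (m + n) = \<phi> m * \<phi> n"
  shows "linear_extension \<phi> (subst_hom g f) = subst_hom (\<lambda>x. linear_extension \<phi> (g x)) f"
  using carrier_poly_ring_UNIV[of f]
  by (induction rule: poly_ring_induct)
    (simp_all add: linear_extension_const linear_extension_mult assms)

lemma subst_hom_compose: "subst_hom h (subst_hom g f) = subst_hom (\<lambda>x. subst_hom h (g x)) f"
  unfolding subst_hom_eq_linear_extension[of h]
  by (rule linear_extension_subst_hom) (simp_all add: eval_monom_add)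

section \<open>Toric ideals\<close>

abbreviation toric_map ::
    "('x \<Rightarrow> 'm) \<Rightarrow> ('x, 'k) polyn \<Rightarrow> 'm::comm_monoid_add \<Rightarrow>\<^sub>0 'k::comm_ring_1" where
  "toric_map A \<equiv> subst_hom (\<lambda>x. monomial (A x))"

definition toric_ideal ::
    "'x set \<Rightarrow> ('x \<Rightarrow> 'm::comm_monoid_add) \<Rightarrow> ('x, 'k::comm_ring_1) polyn set" where
  "toric_ideal X A = {f \<in> carrier (poly_ring X). toric_map A f = 0}"

lemma toric_ideal_cong:
  fixes A B :: "'x \<Rightarrow> 'm::comm_monoid_add"
  assumes "\<And>x. x \<in> X \<Longrightarrow> A x = B x"
  shows "toric_ideal X A = (toric_ideal X B :: ('x, 'k::comm_ring_1) polyn set)"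
proof -
  have "toric_map A f = toric_map B f" if "f \<in> carrier (poly_ring X)" for f :: "('x, 'k) polyn"
    using that by (rule subst_hom_cong) (simp add: assms)
  then show ?thesis by (auto simp: toric_ideal_def)
qed

lemma toric_ideal_inj:
  assumes "additive h" "inj h"
  shows "toric_ideal X (\<lambda>x. h (A x)) = (toric_ideal X A :: ('x, 'k::comm_ring_1) polyn set)"
proof -
  have "toric_map (\<lambda>x. h (A x)) f = map_exponents h (toric_map A f)" for f :: "('x, 'k) polyn"
    unfolding map_exponents_def
    by (subst linear_extension_subst_hom)
      (simp_all add: additive.zero additive.add assms(1) monomial_add)
  then show ?thesis
    by (simp add: toric_ideal_def map_exponents_eq_0_iff assms(2))
qed

lemma toric_map_closed:
  assumes "f \<in> carrier (poly_ring X)"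
  shows "toric_map A f \<in>
    carrier (monoid_algebra (monoid_hull (A ` X)) ::
      ('k::comm_ring_1, 'm::comm_monoid_add \<Rightarrow>\<^sub>0 'k) module)"
proof -
  interpret S: cring "monoid_algebra (monoid_hull (A ` X)) :: ('k, 'm \<Rightarrow>\<^sub>0 'k) module"
    by (rule cring_monoid_algebra)
  show ?thesis
    using assms
  proof (induction rule: poly_ring_induct)
    case (const c)
    show ?case using keys_const[of c] monoid_hull.zero by auto
  next
    case (var x)
    then show ?case by (simp add: monomial_def monoid_hull_incl)
  next
    case (add f g)
    then show ?case using S.a_closed by simp
  next
    case (mult f g)
    then show ?case using S.m_closed by simp
  qed
qed

lemma toric_map_onto:
  fixes g :: "'m::comm_monoid_add \<Rightarrow>\<^sub>0 'k::comm_ring_1"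
  assumes "keys g \<subseteq> monoid_hull (A ` X)"
  shows "\<exists>f\<in>carrier (poly_ring X). toric_map A f = g"
  using assms
proof (induction g rule: poly_mapping_induct)
  case zero
  show ?case by (rule bexI[of _ 0]) simp_all
next
  case (single m c)
  then have "\<exists>f\<in>carrier (poly_ring X). toric_map A f = (monomial m :: 'm \<Rightarrow>\<^sub>0 'k)"
  proof induction
    case zero
    show ?case by (rule bexI[of _ 1]) simp_all
  next
    case (add b m)
    then obtain x f where "b = A x" "x \<in> X"
        "f \<in> carrier (poly_ring X)" "toric_map A f = (monomial m :: 'm \<Rightarrow>\<^sub>0 'k)"
      by blast
    then show ?case by (intro bexI[of _ "var x * f"]) (simp_all add: monomial_add)
  qed
  then obtain f where "f \<in> carrier (poly_ring X)" "toric_map A f = (monomial m :: 'm \<Rightarrow>\<^sub>0 'k)"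
    by blast
  then show ?case
    by (intro bexI[of _ "const c * f"]) (simp_all add: single_eq_const_mult_monomial)
next
  case (add g h)
  then obtain f f' where "f \<in> carrier (poly_ring X)" "f' \<in> carrier (poly_ring X)"
      "toric_map A f = g" "toric_map A f' = h"
    by blast
  then show ?case by (intro bexI[of _ "f + f'"]) simp_all
qed

lemma toric_map_image:
  "toric_map A ` carrier (poly_ring X) =
    carrier (monoid_algebra (monoid_hull (A ` X)) ::
      ('k::comm_ring_1, 'm::comm_monoid_add \<Rightarrow>\<^sub>0 'k) module)"
proof (rule equalityI; rule subsetI)
  fix g :: "'m \<Rightarrow>\<^sub>0 'k"
  assume "g \<in> toric_map A ` carrier (poly_ring X)"
  then show "g \<in> carrier (monoid_algebra (monoid_hull (A ` X)) :: ('k, _) module)"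
    by (elim imageE) (simp only: toric_map_closed)
next
  fix g :: "'m \<Rightarrow>\<^sub>0 'k"
  assume "g \<in> carrier (monoid_algebra (monoid_hull (A ` X)) :: ('k, _) module)"
  then show "g \<in> toric_map A ` carrier (poly_ring X)"
    using toric_map_onto[of g A X] by (auto intro: rev_image_eqI)
qed

lemma toric_ring_hom:
  "ring_hom_ring (poly_ring X) (monoid_algebra (monoid_hull (A ` X)) :: ('k::comm_ring_1, _) module)
    (toric_map A)"
proof -
  interpret S: cring "monoid_algebra (monoid_hull (A ` X)) :: ('k, _) module"
    by (rule cring_monoid_algebra)
  show ?thesis
  proof (intro ring_hom_ringI2 poly_ring.ring_axioms S.ring_axioms ring_hom_memI)
    fix f :: "('a, 'k) polyn"
    assume "f \<in> carrier (poly_ring X)"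
    then show "toric_map A f \<in> carrier (monoid_algebra (monoid_hull (A ` X)) :: ('k, _) module)"
      by (rule toric_map_closed)
  qed simp_all
qed

lemma toric_ideal_eq_kernel:
  "toric_ideal X A = a_kernel (poly_ring X) (monoid_algebra (monoid_hull (A ` X))) (toric_map A)"
  by (simp add: toric_ideal_def a_kernel_def')

lemma toric_ideal_is_ideal: "ideal (toric_ideal X A) (poly_ring X)"
  unfolding toric_ideal_eq_kernel
  by (rule ring_hom_ring.kernel_is_ideal[OF toric_ring_hom])

lemma diff_subst_var_in_ideal:
  fixes f :: "('x, 'k::comm_ring_1) polyn"
  assumes "ideal J (poly_ring X)"
    and \<rho>: "\<And>x. x \<in> X \<Longrightarrow> \<rho> x \<in> X" "\<And>x. x \<in> X \<Longrightarrow> var x - var (\<rho> x) \<in> J"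
    and "f \<in> carrier (poly_ring X)"
  shows "f - subst_hom (\<lambda>x. var (\<rho> x)) f \<in> J"
proof -
  let ?s = "subst_hom (\<lambda>x. var (\<rho> x)) :: ('x, 'k) polyn \<Rightarrow> ('x, 'k) polyn"
  interpret J: ideal J "poly_ring X" by (rule assms(1))
  show ?thesis
    using assms(4)
  proof (induction rule: poly_ring_induct)
    case (const c)
    then show ?case using J.zero_closed by simp
  next
    case (var x)
    then show ?case by (simp add: \<rho>(2))
  next
    case (add f g)
    then have "(f - ?s f) + (g - ?s g) \<in> J" using J.a_closed by simp
    then show ?case by (simp add: algebra_simps)
  next
    case (mult f g)
    have "?s f \<in> carrier (poly_ring X)"
      using mult.hyps(1) by (rule subst_hom_in_poly_ring) (simp add: \<rho>(1))
    then have "?s f * (g - ?s g) \<in> J"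
      using J.I_l_closed[OF mult.IH(2)] by simp
    moreover have "(f - ?s f) * g \<in> J"
      using J.I_r_closed[OF mult.IH(1) mult.hyps(2)] by simp
    ultimately have "(f - ?s f) * g + ?s f * (g - ?s g) \<in> J"
      using J.a_closed by simp
    then show ?case by (simp add: algebra_simps)
  qed
qed

lemma subst_var_in_toric_ideal_iff:
  fixes f :: "('y, 'k::comm_ring_1) polyn"
  assumes "f \<in> carrier (poly_ring Y)" "\<And>y. y \<in> Y \<Longrightarrow> \<iota> y \<in> X"
  shows "subst_hom (\<lambda>y. var (\<iota> y)) f \<in> toric_ideal X A \<longleftrightarrow> f \<in> toric_ideal Y (\<lambda>y. A (\<iota> y))"
proof -
  have "subst_hom (\<lambda>y. var (\<iota> y)) f \<in> carrier (poly_ring X)"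
    using assms(1) by (rule subst_hom_in_poly_ring) (simp add: assms(2))
  then show ?thesis by (simp add: toric_ideal_def subst_hom_compose assms(1))
qed

lemma (in ring) genideal_plus_genideal_eqI:
  assumes I: "ideal I R" and sub: "B \<subseteq> I" "C \<subseteq> I"
    and decomp: "\<And>f. f \<in> I \<Longrightarrow> \<exists>g\<in>B. \<exists>h\<in>Idl C. f = g \<oplus> h"
  shows "I = Idl B <+>\<^bsub>R\<^esub> Idl C"
proof (rule equalityI)
  interpret I: ideal I R by (rule I)
  have B: "B \<subseteq> carrier R" and C: "C \<subseteq> carrier R"
    using sub I.a_subset by blast+
  show "I \<subseteq> Idl B <+>\<^bsub>R\<^esub> Idl C"
    using decomp genideal_self[OF B] unfolding set_add_def' by blast
  have "Idl B \<union> Idl C \<subseteq> I"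
    using genideal_minimal[OF I] sub by simp
  then show "Idl B <+>\<^bsub>R\<^esub> Idl C \<subseteq> I"
    using union_genideal[OF genideal_ideal[OF B] genideal_ideal[OF C]] genideal_minimal[OF I]
    by metis
qed

lemma toric_ideal_retract:
  fixes A :: "'x \<Rightarrow> 'm::comm_monoid_add" and \<iota> :: "'y \<Rightarrow> 'x"
  assumes \<iota>: "\<And>y. y \<in> Y \<Longrightarrow> \<iota> y \<in> X"
    and \<pi>: "\<And>x. x \<in> X \<Longrightarrow> \<pi> x \<in> Y" "\<And>x. x \<in> X \<Longrightarrow> A (\<iota> (\<pi> x)) = A x"
  shows "toric_ideal X A =
    Idl\<^bsub>poly_ring X\<^esub> (subst_hom (\<lambda>y. var (\<iota> y)) ` toric_ideal Y (\<lambda>y. A (\<iota> y)))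
    <+>\<^bsub>poly_ring X\<^esub> Idl\<^bsub>poly_ring X\<^esub> ((\<lambda>x. var x - var (\<iota> (\<pi> x)) :: ('x, 'k::comm_ring_1) polyn) ` X)"
proof (rule poly_ring.genideal_plus_genideal_eqI[OF toric_ideal_is_ideal])
  let ?ext = "subst_hom (\<lambda>y. var (\<iota> y)) :: ('y, 'k) polyn \<Rightarrow> ('x, 'k) polyn"
  let ?res = "subst_hom (\<lambda>x. var (\<pi> x)) :: ('x, 'k) polyn \<Rightarrow> ('y, 'k) polyn"
  let ?lin = "\<lambda>x. var x - var (\<iota> (\<pi> x)) :: ('x, 'k) polyn"
  show "?ext ` toric_ideal Y (\<lambda>y. A (\<iota> y)) \<subseteq> toric_ideal X A"
  proof (rule image_subsetI)
    fix f :: "('y, 'k) polyn"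
    assume f: "f \<in> toric_ideal Y (\<lambda>y. A (\<iota> y))"
    then have "f \<in> carrier (poly_ring Y)" by (simp add: toric_ideal_def)
    then show "?ext f \<in> toric_ideal X A"
      using f by (simp add: subst_var_in_toric_ideal_iff \<iota>)
  qed
  show "?lin ` X \<subseteq> toric_ideal X A"
    by (auto simp: toric_ideal_def \<iota> \<pi>)
  then have lin: "?lin ` X \<subseteq> carrier (poly_ring X)"
    by (auto simp: toric_ideal_def)
  fix f :: "('x, 'k) polyn"
  assume f: "f \<in> toric_ideal X A"
  then have "f \<in> carrier (poly_ring X)" by (simp add: toric_ideal_def)
  have "toric_map (\<lambda>x. A (\<iota> (\<pi> x))) f = toric_map A f"
    using \<open>f \<in> carrier (poly_ring X)\<close> by (rule subst_hom_cong) (simp add: \<pi>)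
  then have "?res f \<in> toric_ideal Y (\<lambda>y. A (\<iota> y))"
    using f by (subst subst_var_in_toric_ideal_iff[of _ X]) (simp_all add: \<pi>(1) toric_ideal_def)
  moreover have "f - ?ext (?res f) \<in> Idl\<^bsub>poly_ring X\<^esub> (?lin ` X)"
    unfolding subst_hom_compose subst_hom_var
    using poly_ring.genideal_ideal[OF lin] _ _ \<open>f \<in> carrier (poly_ring X)\<close>
    by (rule diff_subst_var_in_ideal) (use poly_ring.genideal_self[OF lin] in \<open>auto simp: \<iota> \<pi>\<close>)
  ultimately show "\<exists>g\<in>?ext ` toric_ideal Y (\<lambda>y. A (\<iota> y)). \<exists>h\<in>Idl\<^bsub>poly_ring X\<^esub> (?lin ` X).
      f = g \<oplus>\<^bsub>poly_ring X\<^esub> h"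
    by (intro bexI[of _ "?ext (?res f)"] bexI[of _ "f - ?ext (?res f)"]) simp_all
qed

lemma linear_form_diff_var: "linear_form (var x - var y :: ('x, 'k::comm_ring_1) polyn)"
proof -
  have "keys (var x - var y :: ('x, 'k) polyn) \<subseteq> {single x 1, single y 1}"
    by (auto simp: var_def monomial_def in_keys_iff lookup_minus lookup_single when_def
        split: if_splits)
  then show ?thesis unfolding linear_form_def by auto
qed

section \<open>Binomials\<close>

definition var_binomial :: "nat \<Rightarrow> nat \<Rightarrow> (nat \<Rightarrow> 'x) \<Rightarrow> ('x, 'k::comm_ring_1) polyn" where
  "var_binomial h k p = (\<Prod>j\<in>{1..h}. var (p j)) - (\<Prod>j\<in>{h + 1..h + k}. var (p j))"

lemma var_binomial_cong:
  "\<forall>j\<in>{1..h + k}. p j = q j \<Longrightarrow> var_binomial h k p = var_binomial h k q"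
  by (simp add: var_binomial_def)

lemma var_binomial_in_toric_ideal_iff:
  assumes "\<forall>j\<in>{1..h + k}. p j \<in> X"
  shows "(var_binomial h k p :: ('x, 'k::comm_ring_1) polyn) \<in> toric_ideal X A \<longleftrightarrow>
    (\<Sum>j\<in>{1..h}. A (p j)) = (\<Sum>j\<in>{h + 1..h + k}. A (p j))"
proof -
  have "(var_binomial h k p :: ('x, 'k) polyn) \<in> carrier (poly_ring X)"
    unfolding var_binomial_def by (intro diff_in_poly_ring prod_in_poly_ring) (simp_all add: assms)
  then show ?thesis
    by (simp add: toric_ideal_def var_binomial_def flip: monomial_sum)
qed

lemma monomial_eq_prod_list_var:
  assumes "keys m \<subseteq> X"
  shows "\<exists>xs. set xs \<subseteq> X \<and> (monomial m :: ('x, 'k::comm_ring_1) polyn) = prod_list (map var xs)"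
  using assms
proof (induction m rule: poly_mapping_induct)
  case zero
  show ?case by (rule exI[of _ "[]"]) simp
next
  case (single x n)
  then show ?case
    by (intro exI[of _ "replicate n x"]) (auto simp: var_power)
next
  case (add m n)
  then obtain xs ys where "set xs \<subseteq> X" "(monomial m :: ('x, 'k) polyn) = prod_list (map var xs)"
      "set ys \<subseteq> X" "(monomial n :: ('x, 'k) polyn) = prod_list (map var ys)"
    by blast
  then show ?case
    by (intro exI[of _ "xs @ ys"]) (simp add: monomial_add)
qed

lemma diff_prod_list_var_eq_var_binomial:
  "prod_list (map var xs) - prod_list (map var ys) =
    (var_binomial (length xs) (length ys) (\<lambda>j. (xs @ ys) ! (j - 1)) :: ('x, 'k::comm_ring_1) polyn)"
proof -
  let ?v = "\<lambda>j. var ((xs @ ys) ! (j - 1)) :: ('x, 'k) polyn"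
  have prod: "(prod_list (map var zs) :: ('x, 'k) polyn) = (\<Prod>j\<in>{1..length zs}. var (zs ! (j - 1)))"
    for zs
    by (simp add: prod.list_conv_set_nth prod.atLeast1_atMost_eq atLeast0LessThan)
  have "(\<Prod>j\<in>{length xs + 1..length xs + length ys}. ?v j) =
      (\<Prod>j\<in>{1..length ys}. ?v (j + length xs))"
    using prod.shift_bounds_cl_nat_ivl[of ?v 1 "length xs" "length ys"] by (simp add: add.commute)
  also have "\<dots> = (\<Prod>j\<in>{1..length ys}. var (ys ! (j - 1)))"
    by (rule prod.cong) (auto simp: nth_append)
  finally have "(\<Prod>j\<in>{length xs + 1..length xs + length ys}. ?v j) = prod_list (map var ys)"
    by (simp only: prod)
  moreover have "(\<Prod>j\<in>{1..length xs}. ?v j) = prod_list (map var xs)"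
    unfolding prod by (rule prod.cong) (auto simp: nth_append)
  ultimately show ?thesis by (simp add: var_binomial_def)
qed

lemma binomial_eq_var_binomial:
  fixes f :: "('x, 'k::comm_ring_1) polyn"
  assumes "f \<in> binomials X"
  shows "\<exists>h k p. (\<forall>j\<in>{1..h + k}. p j \<in> X) \<and> f = var_binomial h k p"
proof -
  obtain m n where f: "f = monomial m - monomial n" "keys m \<subseteq> X" "keys n \<subseteq> X"
    using assms by (auto simp: binomials_def)
  obtain xs ys where xs: "set xs \<subseteq> X" "(monomial m :: ('x, 'k) polyn) = prod_list (map var xs)"
    and ys: "set ys \<subseteq> X" "(monomial n :: ('x, 'k) polyn) = prod_list (map var ys)"
    using f(2,3) monomial_eq_prod_list_var by metis
  have "(xs @ ys) ! (j - 1) \<in> X" if "j \<in> {1..length xs + length ys}" for j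
  proof -
    have "(xs @ ys) ! (j - 1) \<in> set (xs @ ys)" using that by (intro nth_mem) auto
    then show ?thesis using xs(1) ys(1) by auto
  qed
  moreover have "f = var_binomial (length xs) (length ys) (\<lambda>j. (xs @ ys) ! (j - 1))"
    by (simp add: f xs ys diff_prod_list_var_eq_var_binomial)
  ultimately show ?thesis
    by (intro exI[of _ "length xs"] exI[of _ "length ys"] exI conjI ballI)
qed

section \<open>Cut varieties as spectra of monoid algebras\<close>

lemma aff_iso_trans:
  assumes "X \<cong>\<^sub>a Y" "Y \<cong>\<^sub>a Z"
  shows "X \<cong>\<^sub>a Z"
proof -
  obtain g where g: "g \<in> ring_iso X Y" "\<forall>c. \<forall>f\<in>carrier X. g (c \<odot>\<^bsub>X\<^esub> f) = c \<odot>\<^bsub>Y\<^esub> g f"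
    using assms(1) by (auto simp: aff_iso_def)
  obtain h where h: "h \<in> ring_iso Y Z" "\<forall>c. \<forall>f\<in>carrier Y. h (c \<odot>\<^bsub>Y\<^esub> f) = c \<odot>\<^bsub>Z\<^esub> h f"
    using assms(2) by (auto simp: aff_iso_def)
  have "(h \<circ> g) (c \<odot>\<^bsub>X\<^esub> f) = c \<odot>\<^bsub>Z\<^esub> (h \<circ> g) f" if "f \<in> carrier X" for c f
    using g h ring_iso_memE(1)[OF g(1)] that by simp
  then show ?thesis
    using ring_iso_set_trans[OF g(1) h(1)] unfolding aff_iso_def
    by (intro bexI[of _ "h \<circ> g"] allI ballI)
qed

lemma aff_iso_sym:
  assumes "ring X" and smult: "\<And>c f. f \<in> carrier X \<Longrightarrow> c \<odot>\<^bsub>X\<^esub> f \<in> carrier X"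
    and "X \<cong>\<^sub>a Y"
  shows "Y \<cong>\<^sub>a X"
proof -
  obtain h where h: "h \<in> ring_iso X Y"
    and lin: "\<And>c f. f \<in> carrier X \<Longrightarrow> h (c \<odot>\<^bsub>X\<^esub> f) = c \<odot>\<^bsub>Y\<^esub> h f"
    using assms(3) by (auto simp: aff_iso_def)
  let ?g = "inv_into (carrier X) h"
  have bij: "bij_betw h (carrier X) (carrier Y)"
    using h by (simp add: ring_iso_def)
  have "?g (c \<odot>\<^bsub>Y\<^esub> y) = c \<odot>\<^bsub>X\<^esub> ?g y" if "y \<in> carrier Y" for c y
  proof -
    have "?g y \<in> carrier X" "h (?g y) = y"
      using bij that by (simp_all add: bij_betw_def inv_into_into f_inv_into_f)
    then have "c \<odot>\<^bsub>Y\<^esub> y = h (c \<odot>\<^bsub>X\<^esub> ?g y)"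
      by (simp add: lin)
    then show ?thesis
      using bij \<open>?g y \<in> carrier X\<close> smult by (simp add: bij_betw_def)
  qed
  then show ?thesis
    using ring_iso_set_sym[OF assms(1) h] unfolding aff_iso_def
    by (intro bexI[of _ ?g] allI ballI)
qed

lemma monoid_algebra_trivial_iso_point:
  "(monoid_algebra {0} :: ('k::field, 'm::comm_monoid_add \<Rightarrow>\<^sub>0 'k) module) \<cong>\<^sub>a point"
proof -
  let ?M = "monoid_algebra {0} :: ('k, 'm \<Rightarrow>\<^sub>0 'k) module"
  let ?h = "\<lambda>f :: 'm \<Rightarrow>\<^sub>0 'k. lookup f 0"
  have lookup_const: "?h (const c) = c" for c
    by (simp add: const_def)
  have const_lookup: "const (?h f) = f" if "f \<in> carrier ?M" for f
  proof (rule poly_mapping_eqI)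
    fix m
    have "lookup f m = 0" if "m \<noteq> 0"
      using that \<open>f \<in> carrier ?M\<close> in_keys_iff[of m f] by auto
    then show "lookup (const (?h f)) m = lookup f m"
      by (simp add: const_def lookup_single when_def)
  qed
  have const_closed: "const c \<in> carrier ?M" for c
    using keys_const[of c] by simp
  have mult: "?h (f * g) = ?h f * ?h g" if "f \<in> carrier ?M" "g \<in> carrier ?M" for f g
    using lookup_const[of "?h f * ?h g"] unfolding const_mult
    by (simp only: const_lookup[OF that(1)] const_lookup[OF that(2)])
  have point: "carrier point = (UNIV :: 'k set)" "one point = (1 :: 'k)"
      "mult point = ((*) :: 'k \<Rightarrow> _)" "add point = ((+) :: 'k \<Rightarrow> _)" "smult point = ((*) :: 'k \<Rightarrow> _)"
    by (simp_all add: point_def)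
  have "bij_betw ?h (carrier ?M) (carrier point)"
    by (rule bij_betwI[where g = const])
      (simp_all add: point const_closed const_lookup lookup_const del: monoid_algebra_simps)
  then have "?h \<in> ring_iso ?M point"
    by (intro ring_iso_memI) (simp_all add: point lookup_add mult)
  moreover have "?h (c \<odot>\<^bsub>?M\<^esub> f) = c \<odot>\<^bsub>point\<^esub> ?h f" if "f \<in> carrier ?M" for c f
    using mult[OF const_closed that, of c] by (simp add: point lookup_const)
  ultimately show ?thesis unfolding aff_iso_def by (intro bexI[of _ ?h] allI ballI)
qed

lemma Aff_simps [simp]:
  "carrier (Aff G) = carrier (cut_ring G Quot cut_ideal G)"
  "mult (Aff G) = mult (cut_ring G Quot cut_ideal G)"
  "one (Aff G) = one (cut_ring G Quot cut_ideal G)"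
  "zero (Aff G) = zero (cut_ring G Quot cut_ideal G)"
  "add (Aff G) = add (cut_ring G Quot cut_ideal G)"
  "smult (Aff G) =
    (\<lambda>c X. (cut_ideal G +>\<^bsub>cut_ring G\<^esub> const c) \<otimes>\<^bsub>cut_ring G Quot cut_ideal G\<^esub> X)"
  by (simp_all add: Aff_def Let_def ring.defs module.defs)

lemma ring_iso_Aff: "h \<in> ring_iso (Aff G) Y \<longleftrightarrow> h \<in> ring_iso (cut_ring G Quot cut_ideal G) Y"
  by (simp add: ring_iso_def ring_hom_def)

context
  fixes G :: "('v, 'l) lmgraph" and A :: "'v set set \<Rightarrow> 'm::comm_monoid_add"
  assumes toric:
    "(cut_ideal G :: ('v, 'k::field) cut_poly set) = toric_ideal (partitions (verts G)) A"
begin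

lemma ideal_cut_ideal: "ideal (cut_ideal G) (cut_ring G :: ('v, 'k) cut_poly ring)"
  unfolding toric cut_ring_def by (rule toric_ideal_is_ideal)

lemma ring_Aff: "ring (Aff G :: ('k, ('v, 'k) cut_poly set) module)"
proof -
  let ?Q = "cut_ring G Quot cut_ideal G :: ('v, 'k) cut_poly set ring"
  interpret Q: ring ?Q
    by (rule ideal.quotient_is_ring[OF ideal_cut_ideal])
  have "id \<in> ring_iso ?Q (Aff G)"
    by (rule ring_iso_memI) simp_all
  then have "ring (Aff G\<lparr>zero := zero ?Q\<rparr> :: ('k, ('v, 'k) cut_poly set) module)"
    using Q.ring_iso_imp_img_ring by fastforce
  then show ?thesis
    by (simp flip: Aff_simps(4))
qed

lemma smult_Aff_closed:
  assumes "X \<in> carrier (Aff G)"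
  shows "c \<odot>\<^bsub>Aff G\<^esub> X \<in> carrier (Aff G :: ('k, ('v, 'k) cut_poly set) module)"
proof -
  let ?R = "cut_ring G :: ('v, 'k) cut_poly ring"
  interpret ring_hom_ring ?R "?R Quot cut_ideal G" "(+>\<^bsub>?R\<^esub>) (cut_ideal G)"
    by (rule ideal.rcos_ring_hom_ring[OF ideal_cut_ideal])
  show ?thesis
    using assms S.m_closed[OF hom_closed[of "const c"]] by (simp add: cut_ring_def)
qed

theorem Aff_iso_monoid_algebra:
  "(Aff G :: ('k, _) module) \<cong>\<^sub>a monoid_algebra (monoid_hull (A ` partitions (verts G)))"
proof -
  let ?R = "cut_ring G :: ('v, 'k) cut_poly ring" and ?I = "cut_ideal G :: ('v, 'k) cut_poly set"
  let ?M = "monoid_algebra (monoid_hull (A ` partitions (verts G))) :: ('k, 'm \<Rightarrow>\<^sub>0 'k) module"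
  let ?\<phi> = "toric_map A :: ('v, 'k) cut_poly \<Rightarrow> 'm \<Rightarrow>\<^sub>0 'k"
  let ?h = "\<lambda>X. the_elem (?\<phi> ` X)"
  interpret ring_hom_ring ?R ?M ?\<phi>
    unfolding cut_ring_def by (rule toric_ring_hom)
  interpret Q: ring_hom_ring ?R "?R Quot ?I" "(+>\<^bsub>?R\<^esub>) ?I"
    by (rule ideal.rcos_ring_hom_ring[OF ideal_cut_ideal])
  have kernel: "a_kernel ?R ?M ?\<phi> = ?I"
    by (simp add: toric toric_ideal_eq_kernel cut_ring_def)
  have "?\<phi> ` carrier ?R = carrier ?M"
    unfolding cut_ring_def by (rule toric_map_image)
  from FactRing_iso_set[OF this] have h: "?h \<in> ring_iso (?R Quot ?I) ?M"
    unfolding kernel .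
  have "?h (c \<odot>\<^bsub>Aff G\<^esub> X) = c \<odot>\<^bsub>?M\<^esub> ?h X" if X: "X \<in> carrier (Aff G)" for c X
  proof -
    have c: "const c \<in> carrier ?R" by (simp add: cut_ring_def)
    then have "?I +>\<^bsub>?R\<^esub> const c \<in> carrier (?R Quot ?I)"
      by (rule Q.hom_closed)
    then have "?h (c \<odot>\<^bsub>Aff G\<^esub> X) = ?h (?I +>\<^bsub>?R\<^esub> const c) * ?h X"
      using ring_iso_memE(2)[OF h] X by simp
    also have "?h (?I +>\<^bsub>?R\<^esub> const c) = const c"
      using the_elem_simp[OF c] by (simp add: kernel)
    finally show ?thesis by simp
  qed
  moreover have "?h \<in> ring_iso (Aff G) ?M"
    unfolding ring_iso_Aff by (rule h)
  ultimately show ?thesis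
    unfolding aff_iso_def by (intro bexI[of _ ?h] allI ballI)
qed

end

corollary Aff_iso_if_exponents_eq:
  assumes "(cut_ideal G :: ('v, 'k::field) cut_poly set) = toric_ideal (partitions (verts G)) A"
    and "(cut_ideal H :: ('w, 'k) cut_poly set) = toric_ideal (partitions (verts H)) B"
    and "A ` partitions (verts G) = B ` partitions (verts H)"
  shows "(Aff G :: ('k, _) module) \<cong>\<^sub>a Aff H"
proof (rule aff_iso_trans)
  let ?M = "monoid_algebra (monoid_hull (A ` partitions (verts G))) :: ('k, _) module"
  show "Aff G \<cong>\<^sub>a ?M"
    using assms(1) by (rule Aff_iso_monoid_algebra)
  have "Aff H \<cong>\<^sub>a ?M"
    unfolding assms(3) using assms(2) by (rule Aff_iso_monoid_algebra)
  then show "?M \<cong>\<^sub>a Aff H"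
    by (intro aff_iso_sym[OF ring_Aff[OF assms(2)]] smult_Aff_closed[OF assms(2)])
qed

section \<open>Maps of integer exponent vectors\<close>

lemma additive_frag_extend: "additive (frag_extend f)"
  by (rule additive.intro) (rule frag_extend_add)

lemma frag_cmul_single: "frag_cmul k (single x c) = single x (k * c)"
  by (rule poly_mapping_eqI) (simp add: lookup_single when_def)

lemma frag_extend_single: "frag_extend f (single x c) = frag_cmul c (f x)"
  using frag_extend_cmul[of f c "frag_of x"] by (simp add: frag_cmul_single)

lemma inj_frag_extend_frag_of:
  assumes "inj f"
  shows "inj (frag_extend (frag_of \<circ> f))"
proof (rule inj_on_inverseI)
  fix m
  have "(frag_of \<circ> inv_into UNIV f) \<circ> f = frag_of" using assms by (simp add: fun_eq_iff)
  then show "frag_extend (frag_of \<circ> inv_into UNIV f) (frag_extend (frag_of \<circ> f) m) = m"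
    unfolding frag_extend_compose by (simp flip: frag_expansion)
qed

definition frag_retract :: "('x \<Rightarrow> 'y) \<Rightarrow> ('y \<Rightarrow>\<^sub>0 int) \<Rightarrow> ('x \<Rightarrow>\<^sub>0 int)" where
  "frag_retract f = frag_extend (\<lambda>z. if z \<in> range f then frag_of (inv_into UNIV f z) else 0)"

lemma frag_retract_add:
  assumes "inj f" "range f \<inter> range g = {}"
  shows "frag_retract f (frag_extend (frag_of \<circ> f) m + frag_extend (frag_of \<circ> g) n) = m"
proof -
  let ?r = "\<lambda>z. if z \<in> range f then frag_of (inv_into UNIV f z) else 0"
  have "?r \<circ> f = frag_of" using assms(1) by (simp add: fun_eq_iff)
  moreover have "frag_extend (?r \<circ> g) n = 0"
    using assms(2) by (intro frag_extend_eq_0) auto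
  ultimately show ?thesis
    unfolding frag_retract_def frag_extend_add frag_extend_compose by (simp flip: frag_expansion)
qed

lemma frag_extend_add_eq_iff:
  assumes "inj f" "inj g" and disjoint: "range f \<inter> range g = {}"
  shows "frag_extend (frag_of \<circ> f) m + frag_extend (frag_of \<circ> g) n =
      frag_extend (frag_of \<circ> f) m' + frag_extend (frag_of \<circ> g) n' \<longleftrightarrow> m = m' \<and> n = n'"
    (is "?l = ?r \<longleftrightarrow> _")
proof
  assume eq: "?l = ?r"
  have "m = m'"
    using arg_cong[OF eq, of "frag_retract f"]
    by (simp only: frag_retract_add[OF assms(1) disjoint])
  moreover have "range g \<inter> range f = {}" using disjoint by blast
  then have "n = n'"
    using arg_cong[OF eq, of "frag_retract g"]
    by (simp only: frag_retract_add[OF assms(2)] add.commute[of "frag_extend (frag_of \<circ> f) _"])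
  ultimately show "m = m' \<and> n = n'" ..
qed simp

definition rescale :: "('x \<Rightarrow> int) \<Rightarrow> ('x \<Rightarrow>\<^sub>0 int) \<Rightarrow> ('x \<Rightarrow>\<^sub>0 int)" where
  "rescale k = frag_extend (\<lambda>x. single x (k x))"

lemma lookup_rescale: "lookup (rescale k m) x = k x * lookup m x"
  using subset_UNIV unfolding rescale_def
  by (induction m rule: frag_induction)
    (auto simp: frag_extend_diff lookup_minus lookup_single when_def right_diff_distrib)

lemma additive_rescale: "additive (rescale k)"
  unfolding rescale_def by (rule additive_frag_extend)

lemma rescale_single: "rescale k (single x c) = single x (k x * c)"
  by (simp add: rescale_def frag_extend_single frag_cmul_single mult.commute)

lemma inj_rescale:
  assumes "\<And>x. k x \<noteq> 0"
  shows "inj (rescale k)"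
proof (rule injI, rule poly_mapping_eqI)
  fix m n x assume "rescale k m = rescale k n"
  then have "k x * lookup m x = k x * lookup n x" by (metis lookup_rescale)
  then show "lookup m x = lookup n x" using assms by simp
qed

definition rename_labels :: "('l \<Rightarrow> 'm) \<Rightarrow> ('l tvar \<Rightarrow>\<^sub>0 int) \<Rightarrow> ('m tvar \<Rightarrow>\<^sub>0 int)" where
  "rename_labels j = frag_extend (frag_of \<circ> map_tvar j)"

lemma additive_rename_labels: "additive (rename_labels j)"
  unfolding rename_labels_def by (rule additive_frag_extend)

lemma rename_labels_single: "rename_labels j (single x k) = single (map_tvar j x) k"
  by (simp add: rename_labels_def frag_extend_single frag_cmul_single)

lemma rename_labels_id: "rename_labels id = id"
  by (simp add: fun_eq_iff rename_labels_def tvar.map_id0 flip: frag_expansion)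

lemma relabel_eq_map_exponents: "relabel j = map_exponents (rename_labels j)"
proof -
  have "(\<Sum>x\<in>keys m. single (map_tvar j x) (lookup m x)) = rename_labels j m" for m
    by (simp add: rename_labels_def frag_extend_def frag_cmul_single)
  then show ?thesis by (simp add: fun_eq_iff relabel_def map_exponents_eq_sum)
qed

lemma rename_labels_Inl_Inr_eq_iff:
  "rename_labels Inl m + rename_labels Inr n = rename_labels Inl m' + rename_labels Inr n' \<longleftrightarrow>
    m = m' \<and> n = n'"
  unfolding rename_labels_def
proof (rule frag_extend_add_eq_iff)
  have "map_tvar Inl x \<noteq> map_tvar Inr y" for x y
    by (cases x; cases y) simp_all
  then show "range (map_tvar Inl) \<inter> range (map_tvar Inr) = {}" by auto
qed (simp_all add: tvar.inj_map)

lemma inj_rename_labels: "inj j \<Longrightarrow> inj (rename_labels j)"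
  unfolding rename_labels_def by (intro inj_frag_extend_frag_of tvar.inj_map)

section \<open>Exponent vectors of cuts\<close>

abbreviation simple :: "('v, 'l) lmgraph \<Rightarrow> bool" where
  "simple G \<equiv> simple_graph (verts G) (edges G)"

definition edge_var :: "('v, 'l) lmgraph \<Rightarrow> 'v set set \<Rightarrow> 'v set \<Rightarrow> 'l tvar" where
  "edge_var G p e = (if e \<in> cut G p then S (lab G e) else T (lab G e))"

definition cut_exponent :: "('v, 'l) lmgraph \<Rightarrow> 'v set set \<Rightarrow> 'l tvar \<Rightarrow>\<^sub>0 int" where
  "cut_exponent G p = (\<Sum>e\<in>edges G. single (edge_var G p e) (multip G e))"

lemma cut_map_eq_toric_map:
  assumes "finite (edges G)"
  shows "cut_map G = (toric_map (cut_exponent G) :: ('v, 'k::field) cut_poly \<Rightarrow> ('l, 'k) laurent)"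
proof -
  have "(\<Prod>e\<in>cut G p. tvar_power (S (lab G e)) (multip G e)) *
      (\<Prod>e\<in>edges G - cut G p. tvar_power (T (lab G e)) (multip G e)) =
      (monomial (cut_exponent G p) :: ('l, 'k) laurent)" for p
  proof -
    have "cut G p \<subseteq> edges G" by (auto simp: cut_def)
    from prod.subset_diff[OF this assms,
        of "\<lambda>e. monomial (single (edge_var G p e) (multip G e)) :: ('l, 'k) laurent"]
    show ?thesis
      by (simp add: cut_exponent_def monomial_sum edge_var_def tvar_power_def mult.commute)
  qed
  then show ?thesis by (simp add: cut_map_def)
qed

lemma finite_edges: "simple G \<Longrightarrow> finite (edges G)"
  unfolding simple_graph_def by (rule finite_subset[of _ "Pow (verts G)"]) auto

lemma cut_ideal_eq_toric_ideal:
  assumes "simple G"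
  shows "cut_ideal G = toric_ideal (partitions (verts G)) (cut_exponent G)"
  by (simp add: cut_ideal_def a_kernel_def' cut_ring_def torus_ring_def toric_ideal_def
      cut_map_eq_toric_map finite_edges[OF assms])

lemma ordered_partitions_iff:
  "a \<in> ordered_partitions V \<longleftrightarrow> fst a \<union> snd a = V \<and> fst a \<inter> snd a = {}"
  by (cases a) (simp add: ordered_partitions_def)

lemma unordered_in_partitions [simp]: "a \<in> ordered_partitions V \<Longrightarrow> unordered a \<in> partitions V"
  by (simp add: partitions_def)

lemma partitionsE:
  assumes "p \<in> partitions V"
  obtains a where "a \<in> ordered_partitions V" "p = unordered a"
  using assms by (auto simp: partitions_def)

lemma unordered_swap [simp]: "unordered (prod.swap a) = unordered a"
  by (auto simp: unordered_def)

lemma swap_ordered_partitions [simp]: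
  "prod.swap a \<in> ordered_partitions V \<longleftrightarrow> a \<in> ordered_partitions V"
  by (auto simp: ordered_partitions_iff)

lemma trivial_ordered_partition [simp]: "({}, V) \<in> ordered_partitions V"
  by (simp add: ordered_partitions_def)

lemma doubleton_in_cut_iff:
  "{x, y} \<in> cut G (unordered a) \<longleftrightarrow>
    {x, y} \<in> edges G \<and> (x \<in> fst a \<and> y \<in> snd a \<or> y \<in> fst a \<and> x \<in> snd a)"
  by (auto simp: cut_def unordered_def doubleton_eq_iff)

lemma edge_doubletonE:
  assumes "simple G" "e \<in> edges G"
  obtains x y where "e = {x, y}" "x \<in> verts G" "y \<in> verts G"
proof -
  have "card e = 2" "e \<subseteq> verts G" using assms by (auto simp: simple_graph_def)
  then show ?thesis using that by (auto simp: card_2_iff)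
qed

definition pullback :: "('a \<Rightarrow> 'b) \<Rightarrow> 'a set \<Rightarrow> 'b set \<times> 'b set \<Rightarrow> 'a set \<times> 'a set" where
  "pullback f V a = (f -` fst a \<inter> V, f -` snd a \<inter> V)"

lemma pullback_in_ordered_partitions:
  "a \<in> ordered_partitions (f ` V) \<Longrightarrow> pullback f V a \<in> ordered_partitions V"
  by (auto simp: pullback_def ordered_partitions_iff)

lemma edge_var_image:
  assumes "simple G" "e \<in> edges G" "verts G \<subseteq> V"
    and "f ` e \<in> edges H" "lab H (f ` e) = i (lab G e)"
  shows "edge_var H (unordered a) (f ` e) = map_tvar i (edge_var G (unordered (pullback f V a)) e)"
proof -
  obtain x y where "e = {x, y}" "x \<in> V" "y \<in> V"
    using assms(1-3) by (blast elim: edge_doubletonE)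
  then have "f ` e \<in> cut H (unordered a) \<longleftrightarrow> e \<in> cut G (unordered (pullback f V a))"
    using assms(2,4) by (simp add: doubleton_in_cut_iff pullback_def)
  then show ?thesis by (simp add: edge_var_def assms(5))
qed

lemma sum_edge_vars_image:
  assumes "simple G" "verts G \<subseteq> V"
    and "inj_on ((`) f) (edges G)" "(`) f ` edges G \<subseteq> edges H"
    and lab: "\<And>e. e \<in> edges G \<Longrightarrow> lab H (f ` e) = i (lab G e)"
    and multip: "\<And>e. e \<in> edges G \<Longrightarrow> multip H (f ` e) = multip G e"
  shows "(\<Sum>d\<in>(`) f ` edges G. single (edge_var H (unordered a) d) (multip H d)) =
    rename_labels i (cut_exponent G (unordered (pullback f V a)))"
proof -
  have "edge_var H (unordered a) (f ` e) = map_tvar i (edge_var G (unordered (pullback f V a)) e)"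
    if "e \<in> edges G" for e
    by (rule edge_var_image[OF assms(1) that assms(2)]) (use assms(4) that lab in auto)
  then show ?thesis
    by (simp add: sum.reindex[OF assms(3)] multip cut_exponent_def
        additive.sum[OF additive_rename_labels] rename_labels_single)
qed

lemma lookup_cut_exponent_S_plus_T:
  assumes "finite (edges G)"
  shows "lookup (cut_exponent G p) (S c) + lookup (cut_exponent G p) (T c) = label_total G c"
proof -
  have "lookup (cut_exponent G p) (S c) + lookup (cut_exponent G p) (T c) =
      (\<Sum>e\<in>edges G. if lab G e = c then multip G e else 0)"
    unfolding cut_exponent_def lookup_sum sum.distrib[symmetric]
    by (rule sum.cong) (auto simp: edge_var_def lookup_single when_def)
  also have "\<dots> = label_total G c"
    unfolding label_total_def using assms by (simp add: sum.inter_filter)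
  finally show ?thesis .
qed

lemma var_binomial_in_cut_ideal_homogeneous:
  assumes simple_G: "simple G" and "label_total G c \<noteq> 0"
    and p: "\<forall>j\<in>{1..h + k}. p j \<in> partitions (verts G)"
    and "(var_binomial h k p :: ('v, 'k::field) cut_poly) \<in> cut_ideal G"
  shows "h = k"
proof -
  let ?total = "\<lambda>m. lookup m (S c) + lookup m (T c)"
  have eq: "(\<Sum>j\<in>{1..h}. cut_exponent G (p j)) = (\<Sum>j\<in>{h + 1..h + k}. cut_exponent G (p j))"
    using assms(4)
    unfolding cut_ideal_eq_toric_ideal[OF simple_G] var_binomial_in_toric_ideal_iff[OF p] .
  have total: "?total (\<Sum>j\<in>J. cut_exponent G (p j)) = int (card J) * label_total G c" for J
    by (simp add: lookup_sum lookup_cut_exponent_S_plus_T finite_edges[OF simple_G]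
        flip: sum.distrib)
  have "int h * label_total G c = int k * label_total G c"
    using arg_cong[OF eq, of ?total] unfolding total by simp
  then show ?thesis using assms(2) by simp
qed

section \<open>Edgeless graphs and change of multiplicities\<close>

theorem Aff_edgeless_iso_point:
  fixes G :: "('v, 'l) lmgraph"
  assumes simple_G: "simple G" and "edges G = {}"
  shows "(Aff G :: ('k::field, _) module) \<cong>\<^sub>a point"
proof (rule aff_iso_trans)
  have "monoid_hull (cut_exponent G ` partitions (verts G)) = {0}"
    using assms(2) by (intro monoid_hull_trivial) (auto simp: cut_exponent_def)
  with Aff_iso_monoid_algebra[OF cut_ideal_eq_toric_ideal[OF simple_G]]
  show "(Aff G :: ('k, _) module) \<cong>\<^sub>a (monoid_algebra {0} :: ('k, ('l, 'k) laurent) module)"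
    by simp
qed (rule monoid_algebra_trivial_iso_point)

lemma cut_exponent_rescale:
  assumes "edges G' = edges G" and lab: "\<And>e. e \<in> edges G \<Longrightarrow> lab G' e = lab G e"
    and multip: "\<And>e. e \<in> edges G \<Longrightarrow> multip G' e = k (lab G e) * multip G e"
  shows "cut_exponent G' p = rescale (case_tvar k k) (cut_exponent G p)"
proof -
  have cut: "cut G' p = cut G p" using assms(1) by (simp add: cut_def)
  have "rescale (case_tvar k k) (cut_exponent G p) =
      (\<Sum>e\<in>edges G. rescale (case_tvar k k) (single (edge_var G p e) (multip G e)))"
    unfolding cut_exponent_def by (rule additive.sum[OF additive_rescale])
  also have "\<dots> = (\<Sum>e\<in>edges G. single (edge_var G' p e) (multip G' e))"
    by (intro sum.cong refl) (simp add: rescale_single edge_var_def cut lab multip)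
  finally show ?thesis by (simp add: cut_exponent_def assms(1))
qed

lemma cut_ideal_rescale:
  assumes "simple G" "verts G' = verts G" "edges G' = edges G"
    and lab: "\<And>e. e \<in> edges G \<Longrightarrow> lab G' e = lab G e"
    and multip: "\<And>e. e \<in> edges G \<Longrightarrow> multip G' e = k (lab G e) * multip G e"
    and nonzero: "\<And>c. k c \<noteq> 0"
  shows "cut_ideal G' = (cut_ideal G :: ('v, 'k::field) cut_poly set)"
proof -
  have "cut_exponent G' = (\<lambda>p. rescale (case_tvar k k) (cut_exponent G p))"
    using assms(3) lab multip by (intro ext cut_exponent_rescale)
  then have "cut_ideal G' = (toric_ideal (partitions (verts G))
      (\<lambda>p. rescale (case_tvar k k) (cut_exponent G p)) :: ('v, 'k) cut_poly set)"
    using cut_ideal_eq_toric_ideal[of G'] assms(1-3) by simp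
  also have "\<dots> = toric_ideal (partitions (verts G)) (cut_exponent G)"
    using nonzero
    by (intro toric_ideal_inj additive_rescale inj_rescale) (simp split: tvar.split)
  finally show ?thesis
    by (simp only: cut_ideal_eq_toric_ideal[OF assms(1)])
qed

lemma canonical_simps [simp]:
  "verts (canonical V E \<sigma>) = V" "edges (canonical V E \<sigma>) = E"
  "lab (canonical V E \<sigma>) = (\<lambda>e. e)" "multip (canonical V E \<sigma>) = \<sigma>"
  by (simp_all add: canonical_def)

theorem cut_ideal_canonical:
  fixes V :: "'u set" and E :: "'u set set"
  assumes "simple_graph V E" and \<sigma>: "multiplicity_map E \<sigma>"
  shows "(cut_ideal (classical V E) :: ('u, 'k::field) cut_poly set) = cut_ideal (canonical V E \<sigma>)"
proof -
  define k where "k e = (if e \<in> E then \<sigma> e else 1)" for e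
  have "k e \<noteq> 0" "e \<in> E \<Longrightarrow> k e = \<sigma> e" for e
    using \<sigma> by (simp_all add: k_def multiplicity_map_def)
  then show ?thesis
    using assms(1)
    by (intro cut_ideal_rescale[where k = k, symmetric]) (simp_all add: classical_def)
qed

theorem Aff_canonical:
  fixes V :: "'u set" and E :: "'u set set"
  assumes "simple_graph V E" "multiplicity_map E \<sigma>"
  shows "(Aff (classical V E) :: ('k::field, _) module) \<cong>\<^sub>a Aff (canonical V E \<sigma>)"
proof (rule Aff_iso_if_exponents_eq)
  show classical: "cut_ideal (classical V E) = (toric_ideal (partitions (verts (classical V E)))
      (cut_exponent (classical V E)) :: ('u, 'k) cut_poly set)"
    using assms(1) by (intro cut_ideal_eq_toric_ideal) (simp add: classical_def)
  then show "cut_ideal (canonical V E \<sigma>) = (toric_ideal (partitions (verts (canonical V E \<sigma>)))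
      (cut_exponent (classical V E)) :: ('u, 'k) cut_poly set)"
    by (simp add: classical_def flip: cut_ideal_canonical[OF assms])
qed (simp add: classical_def)

section \<open>Disjoint unions\<close>

lemma Inl_in_Plus_iff [simp]: "Inl x \<in> A <+> B \<longleftrightarrow> x \<in> A"
  and Inr_in_Plus_iff [simp]: "Inr y \<in> A <+> B \<longleftrightarrow> y \<in> B"
  by auto

lemma disjoint_union_simps [simp]:
  "verts (disjoint_union G H) = verts G <+> verts H"
  "edges (disjoint_union G H) = (`) Inl ` edges G \<union> (`) Inr ` edges H"
  by (simp_all add: disjoint_union_def)

lemma disjoint_union_Inl [simp]:
  "lab (disjoint_union G H) (Inl ` e) = Inl (lab G e)"
  "multip (disjoint_union G H) (Inl ` e) = multip G e"
  by (simp_all add: disjoint_union_def image_subset_iff inj_vimage_image_eq)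

lemma disjoint_union_Inr:
  fixes G :: "('v, 'l) lmgraph" and H :: "('w, 'm) lmgraph"
  assumes "e \<noteq> {}"
  shows "lab (disjoint_union G H) (Inr ` e) = Inr (lab H e)"
    and "multip (disjoint_union G H) (Inr ` e) = multip H e"
proof -
  have "\<not> (Inr ` e :: ('v + 'w) set) \<subseteq> range Inl" using assms by auto
  then show "lab (disjoint_union G H) (Inr ` e) = Inr (lab H e)"
    "multip (disjoint_union G H) (Inr ` e) = multip H e"
    by (simp_all add: disjoint_union_def inj_vimage_image_eq)
qed

lemma simple_disjoint_union:
  assumes "simple G" "simple H"
  shows "simple (disjoint_union G H)"
  using assms by (auto simp: simple_graph_def card_image)

definition ordered_prod ::
    "'v set \<times> 'v set \<Rightarrow> 'w set \<times> 'w set \<Rightarrow> ('v + 'w) set \<times> ('v + 'w) set" where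
  "ordered_prod a b = (fst a <+> fst b, snd a <+> snd b)"

lemma part_prod_eq_unordered: "part_prod a b = unordered (ordered_prod a b)"
  by (simp add: part_prod_def unordered_def ordered_prod_def Plus_def)

lemma pullback_ordered_prod:
  "pullback Inl UNIV (ordered_prod a b) = a" "pullback Inr UNIV (ordered_prod a b) = b"
  by (auto simp: pullback_def ordered_prod_def prod_eq_iff)

lemma ordered_prod_in_ordered_partitions [simp]:
  assumes "a \<in> ordered_partitions V" "b \<in> ordered_partitions W"
  shows "ordered_prod a b \<in> ordered_partitions (V <+> W)"
  using assms by (auto simp: ordered_prod_def ordered_partitions_def)

lemma part_prod_in_partitions [simp]:
  assumes "a \<in> ordered_partitions V" "b \<in> ordered_partitions W"
  shows "part_prod a b \<in> partitions (V <+> W)"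
  using assms by (simp add: part_prod_eq_unordered)

lemma partitions_PlusE:
  assumes "p \<in> partitions (V <+> W)"
  obtains a b where "a \<in> ordered_partitions V" "b \<in> ordered_partitions W" "p = part_prod a b"
proof -
  obtain c where c: "c \<in> ordered_partitions (V <+> W)" "p = unordered c"
    using assms by (rule partitionsE)
  let ?a = "(Inl -` fst c, Inl -` snd c)" and ?b = "(Inr -` fst c, Inr -` snd c)"
  have split: "(Inl -` C) <+> (Inr -` C) = C" for C :: "('a + 'b) set"
  proof (rule Set.set_eqI)
    fix u show "u \<in> (Inl -` C) <+> (Inr -` C) \<longleftrightarrow> u \<in> C" by (cases u) simp_all
  qed
  have "?a \<in> ordered_partitions V" "?b \<in> ordered_partitions W"
    using c(1) by (auto simp: ordered_partitions_iff)
  moreover have "p = part_prod ?a ?b"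
    by (simp add: c(2) part_prod_eq_unordered ordered_prod_def split)
  ultimately show ?thesis by (rule that)
qed

context
  fixes G :: "('v, 'l) lmgraph" and H :: "('w, 'm) lmgraph"
  assumes simple_G: "simple G" and simple_H: "simple H"
begin

theorem cut_exponent_disjoint_union:
  "cut_exponent (disjoint_union G H) (part_prod a b) =
    rename_labels Inl (cut_exponent G (unordered a)) +
    rename_labels Inr (cut_exponent H (unordered b))"
proof -
  let ?D = "disjoint_union G H" and ?c = "ordered_prod a b"
  let ?t = "\<lambda>e. single (edge_var ?D (unordered ?c) e) (multip ?D e)"
  have nonempty: "e \<noteq> {}" if "e \<in> edges H" for e
    using simple_H that by (auto simp: simple_graph_def)
  then have "(`) Inl ` edges G \<inter> (`) Inr ` edges H = ({} :: ('v + 'w) set set)"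
    by blast
  then have "cut_exponent ?D (unordered ?c) =
      (\<Sum>e\<in>(`) Inl ` edges G. ?t e) + (\<Sum>e\<in>(`) Inr ` edges H. ?t e)"
    unfolding cut_exponent_def disjoint_union_simps
    by (intro sum.union_disjoint)
      (simp_all add: finite_edges[OF simple_G] finite_edges[OF simple_H])
  also have "(\<Sum>e\<in>(`) Inl ` edges G. ?t e) =
      rename_labels Inl (cut_exponent G (unordered (pullback Inl UNIV ?c)))"
    by (rule sum_edge_vars_image[OF simple_G]) (auto simp: inj_on_def inj_image_eq_iff)
  also have "(\<Sum>e\<in>(`) Inr ` edges H. ?t e) =
      rename_labels Inr (cut_exponent H (unordered (pullback Inr UNIV ?c)))"
    by (rule sum_edge_vars_image[OF simple_H])
      (auto simp: inj_on_def inj_image_eq_iff disjoint_union_Inr nonempty)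
  finally show ?thesis
    by (simp add: part_prod_eq_unordered pullback_ordered_prod)
qed

lemma cut_ideal_disjoint_union_eq_toric_ideal:
  "cut_ideal (disjoint_union G H) =
    toric_ideal (partitions (verts (disjoint_union G H))) (cut_exponent (disjoint_union G H))"
  by (rule cut_ideal_eq_toric_ideal[OF simple_disjoint_union[OF simple_G simple_H]])

corollary cut_map_disjoint_union:
  "(cut_map (disjoint_union G H) (var (part_prod a b)) :: ('l + 'm, 'k::field) laurent) =
    relabel Inl (cut_map G (var (unordered a))) * relabel Inr (cut_map H (var (unordered b)))"
  using cut_exponent_disjoint_union finite_edges[OF simple_G] finite_edges[OF simple_H]
  by (simp add: cut_map_eq_toric_map relabel_eq_map_exponents monomial_add)

corollary cut_exponent_part_prod_swap:
  "cut_exponent (disjoint_union G H) (part_prod a (prod.swap b)) =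
    cut_exponent (disjoint_union G H) (part_prod a b)"
  by (simp add: cut_exponent_disjoint_union)

end

section \<open>Clique sums along a vertex\<close>

context
  fixes G :: "('v, 'l) lmgraph" and H :: "('w, 'm) lmgraph" and x y
  assumes simple_G: "simple G" and simple_H: "simple H"
    and x: "x \<in> verts G" and y: "y \<in> verts H"
begin

lemma inj_on_glue_edge: "e \<in> edges (disjoint_union G H) \<Longrightarrow> inj_on (glue x y) e"
  by (auto simp: inj_on_def glue_def)

lemma inj_on_glue_edges: "inj_on ((`) (glue x y)) (edges (disjoint_union G H))"
proof (rule inj_on_inverseI)
  let ?unglue = "\<lambda>d. if d \<subseteq> range Inl then d else (\<lambda>u. if u = Inl x then Inr y else u) ` d"
  fix e assume "e \<in> edges (disjoint_union G H)"
  then consider d where "e = Inl ` d" | d where "d \<in> edges H" "e = Inr ` d" by auto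
  then show "?unglue (glue x y ` e) = e"
  proof cases
    case 1
    then show ?thesis by (auto simp: glue_def image_image)
  next
    case 2
    have "card d = 2" using simple_H 2(1) by (simp add: simple_graph_def)
    then have "\<not> d \<subseteq> {y}" using card_mono[of "{y}" d] by auto
    then obtain z where "z \<in> d" "z \<noteq> y" by blast
    then have "\<not> glue x y ` e \<subseteq> range Inl" by (force simp: glue_def 2(2))
    moreover have "(\<lambda>u. if u = Inl x then Inr y else u) ` glue x y ` e = id ` e"
      unfolding image_image by (rule image_cong) (auto simp: 2(2) glue_def)
    ultimately show ?thesis by simp
  qed
qed

lemma zero_sum_simps:
  "verts (zero_sum x y G H) = glue x y ` verts (disjoint_union G H)"
  "edges (zero_sum x y G H) = (`) (glue x y) ` edges (disjoint_union G H)"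
  "e \<in> edges (disjoint_union G H) \<Longrightarrow>
    lab (zero_sum x y G H) (glue x y ` e) = lab (disjoint_union G H) e"
  "e \<in> edges (disjoint_union G H) \<Longrightarrow>
    multip (zero_sum x y G H) (glue x y ` e) = multip (disjoint_union G H) e"
  by (simp_all add: zero_sum_def Let_def inv_into_f_f[OF inj_on_glue_edges]
      del: disjoint_union_simps)

lemma simple_zero_sum: "simple (zero_sum x y G H)"
proof -
  have D: "simple (disjoint_union G H)"
    by (rule simple_disjoint_union[OF simple_G simple_H])
  have "glue x y ` e \<subseteq> glue x y ` verts (disjoint_union G H) \<and> card (glue x y ` e) = 2"
    if "e \<in> edges (disjoint_union G H)" for e
    using D that card_image[OF inj_on_glue_edge[OF that]]
    by (simp add: simple_graph_def image_mono del: disjoint_union_simps)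
  then show ?thesis
    using D by (simp add: zero_sum_simps simple_graph_def del: disjoint_union_simps)
qed

lemma pullback_glue:
  assumes c: "c \<in> ordered_partitions (verts (disjoint_union G H))"
    and same_side: "Inl x \<in> fst c \<longleftrightarrow> Inr y \<in> fst c"
  defines "a \<equiv> (fst c - {Inr y}, snd c - {Inr y})"
  shows "a \<in> ordered_partitions (verts (zero_sum x y G H))"
    and "pullback (glue x y) (verts (disjoint_union G H)) a = c"
proof -
  have "glue x y ` verts (disjoint_union G H) = verts (disjoint_union G H) - {Inr y}"
    using x by (force simp: glue_def)
  then show "a \<in> ordered_partitions (verts (zero_sum x y G H))"
    using c unfolding a_def zero_sum_simps ordered_partitions_iff by auto
  have "Inl x \<in> snd c \<longleftrightarrow> Inr y \<in> snd c"
    using c same_side x y by (auto simp: ordered_partitions_iff)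
  moreover have "fst c \<subseteq> verts (disjoint_union G H)" "snd c \<subseteq> verts (disjoint_union G H)"
    using c unfolding ordered_partitions_iff by auto
  ultimately show "pullback (glue x y) (verts (disjoint_union G H)) a = c"
    using same_side by (cases c) (auto simp: a_def pullback_def glue_def split: if_splits)
qed

lemma cut_exponent_pullback_glue:
  "cut_exponent (disjoint_union G H)
      (unordered (pullback (glue x y) (verts (disjoint_union G H)) a)) =
    cut_exponent (zero_sum x y G H) (unordered a)"
  using sum_edge_vars_image[OF simple_disjoint_union[OF simple_G simple_H] order_refl
      inj_on_glue_edges, of "zero_sum x y G H" id a]
  by (simp add: zero_sum_simps rename_labels_id cut_exponent_def[of "zero_sum x y G H"]
      del: disjoint_union_simps)

text \<open>Exactly one of \<open>a \<times> b\<close> and \<open>a \<times> b\<^sup>*\<close> does not separate the two vertices to be identified,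
  and this one descends to the clique sum.\<close>

lemma ex_partition_not_separating_glued_vertices:
  assumes "q \<in> partitions (verts (disjoint_union G H))"
  shows "\<exists>c\<in>ordered_partitions (verts (disjoint_union G H)).
    (Inl x \<in> fst c \<longleftrightarrow> Inr y \<in> fst c) \<and>
    cut_exponent (disjoint_union G H) (unordered c) = cut_exponent (disjoint_union G H) q"
proof -
  obtain a b where a: "a \<in> ordered_partitions (verts G)"
    and b: "b \<in> ordered_partitions (verts H)" and q: "q = part_prod a b"
    using assms unfolding disjoint_union_simps by (rule partitions_PlusE)
  define b' where "b' = (if x \<in> fst a \<longleftrightarrow> y \<in> fst b then b else prod.swap b)"
  have "ordered_prod a b' \<in> ordered_partitions (verts (disjoint_union G H))"
    using a b by (simp add: b'_def)
  moreover have "Inl x \<in> fst (ordered_prod a b') \<longleftrightarrow> Inr y \<in> fst (ordered_prod a b')"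
    using b y by (auto simp: b'_def ordered_prod_def ordered_partitions_iff)
  moreover have "cut_exponent (disjoint_union G H) (unordered (ordered_prod a b')) =
      cut_exponent (disjoint_union G H) q"
    by (simp add: q b'_def cut_exponent_part_prod_swap[OF simple_G simple_H]
        flip: part_prod_eq_unordered)
  ultimately show ?thesis by blast
qed

lemma cut_exponents_zero_sum:
  "cut_exponent (disjoint_union G H) ` partitions (verts (disjoint_union G H)) =
    cut_exponent (zero_sum x y G H) ` partitions (verts (zero_sum x y G H))"
proof (rule equalityI; rule image_subsetI)
  fix q assume "q \<in> partitions (verts (disjoint_union G H))"
  from ex_partition_not_separating_glued_vertices[OF this] obtain c
    where c: "c \<in> ordered_partitions (verts (disjoint_union G H))"
      "Inl x \<in> fst c \<longleftrightarrow> Inr y \<in> fst c"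
    and "cut_exponent (disjoint_union G H) (unordered c) = cut_exponent (disjoint_union G H) q"
    by auto
  then have "cut_exponent (disjoint_union G H) q =
      cut_exponent (zero_sum x y G H) (unordered (fst c - {Inr y}, snd c - {Inr y}))"
    using cut_exponent_pullback_glue[of "(fst c - {Inr y}, snd c - {Inr y})"]
    by (simp only: pullback_glue(2)[OF c])
  then show "cut_exponent (disjoint_union G H) q \<in>
      cut_exponent (zero_sum x y G H) ` partitions (verts (zero_sum x y G H))"
    using pullback_glue(1)[OF c] by simp
next
  fix p assume "p \<in> partitions (verts (zero_sum x y G H))"
  then obtain a where "a \<in> ordered_partitions (glue x y ` verts (disjoint_union G H))"
    and "p = unordered a"
    unfolding zero_sum_simps by (rule partitionsE)
  then show "cut_exponent (zero_sum x y G H) p \<in>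
      cut_exponent (disjoint_union G H) ` partitions (verts (disjoint_union G H))"
    by (simp add: imageI pullback_in_ordered_partitions
        del: disjoint_union_simps flip: cut_exponent_pullback_glue)
qed

theorem Aff_zero_sum:
  "(Aff (disjoint_union G H) :: ('k::field, _) module) \<cong>\<^sub>a Aff (zero_sum x y G H)"
  using cut_ideal_disjoint_union_eq_toric_ideal[OF simple_G simple_H]
    cut_ideal_eq_toric_ideal[OF simple_zero_sum] cut_exponents_zero_sum
  by (rule Aff_iso_if_exponents_eq)

end

section \<open>Adding isolated vertices\<close>

lemma cut_ideal_eq_toric_ideal_rename_labels:
  assumes "simple G" "inj j"
  shows "cut_ideal G = toric_ideal (partitions (verts G)) (\<lambda>p. rename_labels j (cut_exponent G p))"
  unfolding cut_ideal_eq_toric_ideal[OF assms(1)]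
  by (intro toric_ideal_inj[symmetric] additive_rename_labels inj_rename_labels assms(2))

context
  fixes G :: "('v, 'l) lmgraph" and H :: "('w, 'm) lmgraph"
  assumes simple_G: "simple G" and simple_H: "simple H"
    and edgeless: "edges H = {}"
begin

lemma cut_exponent_union_edgeless:
  "cut_exponent (disjoint_union G H) (part_prod a b) =
    rename_labels Inl (cut_exponent G (unordered a))"
  using cut_exponent_disjoint_union[OF simple_G simple_H] additive.zero[OF additive_rename_labels]
  by (simp add: cut_exponent_def[of H] edgeless)

lemma cut_exponents_union_edgeless:
  "(\<lambda>p. rename_labels Inl (cut_exponent G p)) ` partitions (verts G) =
    cut_exponent (disjoint_union G H) ` partitions (verts (disjoint_union G H))"
proof (intro equalityI subsetI; elim imageE)
  fix m :: "('l + 'm) tvar \<Rightarrow>\<^sub>0 int" and p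
  assume "m = rename_labels Inl (cut_exponent G p)" "p \<in> partitions (verts G)"
  then obtain a where "a \<in> ordered_partitions (verts G)"
    and "m = rename_labels Inl (cut_exponent G (unordered a))"
    by (auto elim: partitionsE)
  then show "m \<in> cut_exponent (disjoint_union G H) ` partitions (verts (disjoint_union G H))"
    by (intro image_eqI[of _ _ "part_prod a ({}, verts H)"])
      (simp_all add: cut_exponent_union_edgeless)
next
  fix m :: "('l + 'm) tvar \<Rightarrow>\<^sub>0 int" and q
  assume "m = cut_exponent (disjoint_union G H) q" "q \<in> partitions (verts (disjoint_union G H))"
  then obtain a b where "a \<in> ordered_partitions (verts G)"
    and "m = cut_exponent (disjoint_union G H) (part_prod a b)"
    by (auto elim: partitions_PlusE)
  then show "m \<in> (\<lambda>p. rename_labels Inl (cut_exponent G p)) ` partitions (verts G)"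
    by (auto simp: cut_exponent_union_edgeless)
qed

theorem Aff_union_edgeless: "(Aff (disjoint_union G H) :: ('k::field, _) module) \<cong>\<^sub>a Aff G"
  using cut_ideal_disjoint_union_eq_toric_ideal[OF simple_G simple_H]
    cut_ideal_eq_toric_ideal_rename_labels[OF simple_G inj_Inl]
    cut_exponents_union_edgeless[symmetric]
  by (rule Aff_iso_if_exponents_eq)

theorem cut_ideal_union_edgeless:
  fixes R :: "('v + 'w, 'k::field) cut_poly ring"
  assumes ord: "\<forall>p\<in>partitions (verts G).
      ord p \<in> ordered_partitions (verts G) \<and> unordered (ord p) = p"
  defines "R \<equiv> cut_ring (disjoint_union G H)"
  shows "\<exists>L J. L \<subseteq> carrier R \<and> (\<forall>f\<in>L. linear_form f) \<and> J = Idl\<^bsub>R\<^esub> L \<and>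
    cut_ideal (disjoint_union G H) =
      Idl\<^bsub>R\<^esub> (extend_vars ord (verts H) ` cut_ideal G) <+>\<^bsub>R\<^esub> J"
proof -
  let ?D = "disjoint_union G H"
  define extend where "extend p = part_prod (ord p) ({}, verts H)" for p
  have extend_in: "extend p \<in> partitions (verts ?D)" if "p \<in> partitions (verts G)" for p
    using ord that by (simp add: extend_def)
  have extend_exponent: "cut_exponent ?D (extend p) = rename_labels Inl (cut_exponent G p)"
    if "p \<in> partitions (verts G)" for p
    using ord that by (simp add: extend_def cut_exponent_union_edgeless)
  have "\<exists>p\<in>partitions (verts G). cut_exponent ?D (extend p) = cut_exponent ?D q"
    if "q \<in> partitions (verts ?D)" for q
    using imageI[OF that, of "cut_exponent ?D"] extend_exponent
    unfolding cut_exponents_union_edgeless[symmetric] by auto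
  then obtain restrict where restrict: "\<And>q. q \<in> partitions (verts ?D) \<Longrightarrow>
      restrict q \<in> partitions (verts G) \<and> cut_exponent ?D (extend (restrict q)) = cut_exponent ?D q"
    by metis
  let ?L = "(\<lambda>q. var q - var (extend (restrict q)) :: ('v + 'w, 'k) cut_poly)
    ` partitions (verts ?D)"
  have G_ideal: "toric_ideal (partitions (verts G)) (\<lambda>p. cut_exponent ?D (extend p)) =
      (cut_ideal G :: ('v, 'k) cut_poly set)"
    using toric_ideal_cong[OF extend_exponent]
      cut_ideal_eq_toric_ideal_rename_labels[OF simple_G inj_Inl, symmetric]
    by (rule trans)
  have "cut_ideal ?D = toric_ideal (partitions (verts ?D)) (cut_exponent ?D)"
    by (rule cut_ideal_disjoint_union_eq_toric_ideal[OF simple_G simple_H])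
  also have "\<dots> = Idl\<^bsub>R\<^esub> (subst_hom (\<lambda>p. var (extend p)) ` cut_ideal G) <+>\<^bsub>R\<^esub> Idl\<^bsub>R\<^esub> ?L"
    unfolding R_def cut_ring_def G_ideal[symmetric]
    by (rule toric_ideal_retract) (simp_all only: extend_in restrict)
  finally have "cut_ideal ?D =
      Idl\<^bsub>R\<^esub> (extend_vars ord (verts H) ` cut_ideal G) <+>\<^bsub>R\<^esub> Idl\<^bsub>R\<^esub> ?L"
    by (simp only: extend_vars_def extend_def)
  moreover have "?L \<subseteq> carrier R"
    using extend_in restrict by (auto simp: R_def cut_ring_def simp del: disjoint_union_simps)
  ultimately show ?thesis
    by (intro exI[of _ ?L] exI[of _ "Idl\<^bsub>R\<^esub> ?L"]) (auto simp: linear_form_diff_var)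
qed

end

lemma isolated_simps [simp]: "verts (isolated n) = {1..n}" "edges (isolated n) = {}"
  by (simp_all add: isolated_def classical_def)

lemma simple_isolated: "n \<ge> 1 \<Longrightarrow> simple (isolated n)"
  by (simp add: simple_graph_def)

section \<open>Binomials in the ideal of a disjoint union\<close>

context
  fixes G :: "('v, 'l) lmgraph" and H :: "('w, 'm) lmgraph"
  assumes simple_G: "simple G" and simple_H: "simple H"
begin

lemma var_binomial_part_prod_in_cut_ideal_iff:
  assumes factors: "\<forall>j\<in>{1..h + k}.
      a j \<in> ordered_partitions (verts G) \<and> b j \<in> ordered_partitions (verts H)"
  shows "(var_binomial h k (\<lambda>j. part_prod (a j) (b j)) :: ('v + 'w, 'k::field) cut_poly)
      \<in> cut_ideal (disjoint_union G H) \<longleftrightarrow>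
    (var_binomial h k (\<lambda>j. unordered (a j)) :: ('v, 'k) cut_poly) \<in> cut_ideal G \<and>
    (var_binomial h k (\<lambda>j. unordered (b j)) :: ('w, 'k) cut_poly) \<in> cut_ideal H"
proof -
  let ?D = "disjoint_union G H"
  have exponents: "(\<Sum>j\<in>J. cut_exponent ?D (part_prod (a j) (b j))) =
      rename_labels Inl (\<Sum>j\<in>J. cut_exponent G (unordered (a j))) +
      rename_labels Inr (\<Sum>j\<in>J. cut_exponent H (unordered (b j)))" for J
    by (simp add: cut_exponent_disjoint_union[OF simple_G simple_H] sum.distrib
        additive.sum[OF additive_rename_labels])
  have "(var_binomial h k (\<lambda>j. part_prod (a j) (b j)) :: ('v + 'w, 'k) cut_poly) \<in> cut_ideal ?D \<longleftrightarrow>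
      (\<Sum>j\<in>{1..h}. cut_exponent ?D (part_prod (a j) (b j))) =
      (\<Sum>j\<in>{h + 1..h + k}. cut_exponent ?D (part_prod (a j) (b j)))"
    unfolding cut_ideal_disjoint_union_eq_toric_ideal[OF simple_G simple_H]
    by (rule var_binomial_in_toric_ideal_iff) (simp add: factors)
  also have "\<dots> \<longleftrightarrow>
      (\<Sum>j\<in>{1..h}. cut_exponent G (unordered (a j))) =
        (\<Sum>j\<in>{h + 1..h + k}. cut_exponent G (unordered (a j))) \<and>
      (\<Sum>j\<in>{1..h}. cut_exponent H (unordered (b j))) =
        (\<Sum>j\<in>{h + 1..h + k}. cut_exponent H (unordered (b j)))"
    unfolding exponents by (rule rename_labels_Inl_Inr_eq_iff)
  also have "\<dots> \<longleftrightarrow> (var_binomial h k (\<lambda>j. unordered (a j)) :: ('v, 'k) cut_poly) \<in> cut_ideal G \<and>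
      (var_binomial h k (\<lambda>j. unordered (b j)) :: ('w, 'k) cut_poly) \<in> cut_ideal H"
    unfolding cut_ideal_eq_toric_ideal[OF simple_G] cut_ideal_eq_toric_ideal[OF simple_H]
    by (subst (1 2) var_binomial_in_toric_ideal_iff) (simp_all add: factors)
  finally show ?thesis .
qed

lemma product_binomial_iff:
  fixes f :: "('v + 'w, 'k::field) cut_poly"
  shows "product_binomial G H h k f \<longleftrightarrow> f \<in> cut_ideal (disjoint_union G H) \<and>
    (\<exists>p. (\<forall>j\<in>{1..h + k}. p j \<in> partitions (verts (disjoint_union G H))) \<and> f = var_binomial h k p)"
    (is "_ \<longleftrightarrow> _ \<and> ?binomial")
proof
  assume "product_binomial G H h k f"
  then obtain a b where
    factors: "\<forall>j\<in>{1..h + k}.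
      a j \<in> ordered_partitions (verts G) \<and> b j \<in> ordered_partitions (verts H)"
    and f: "f = var_binomial h k (\<lambda>j. part_prod (a j) (b j))"
    and "(var_binomial h k (\<lambda>j. unordered (a j)) :: ('v, 'k) cut_poly) \<in> cut_ideal G"
      "(var_binomial h k (\<lambda>j. unordered (b j)) :: ('w, 'k) cut_poly) \<in> cut_ideal H"
    unfolding product_binomial_def var_binomial_def by blast
  then have "f \<in> cut_ideal (disjoint_union G H)"
    by (simp only: var_binomial_part_prod_in_cut_ideal_iff[OF factors] simp_thms)
  moreover have ?binomial
    using factors f by (intro exI[of _ "\<lambda>j. part_prod (a j) (b j)"]) simp
  ultimately show "f \<in> cut_ideal (disjoint_union G H) \<and> ?binomial" ..
next
  assume "f \<in> cut_ideal (disjoint_union G H) \<and> ?binomial"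
  then obtain p where f: "f \<in> cut_ideal (disjoint_union G H)" "f = var_binomial h k p"
    and p: "\<forall>j\<in>{1..h + k}. p j \<in> partitions (verts G <+> verts H)"
    by auto
  have "\<exists>a b. a \<in> ordered_partitions (verts G) \<and> b \<in> ordered_partitions (verts H) \<and>
      p j = part_prod a b" if "j \<in> {1..h + k}" for j
    using bspec[OF p that] by (elim partitions_PlusE) blast
  then obtain a b where factors: "\<forall>j\<in>{1..h + k}.
      a j \<in> ordered_partitions (verts G) \<and> b j \<in> ordered_partitions (verts H)"
    and "\<forall>j\<in>{1..h + k}. p j = part_prod (a j) (b j)"
    by metis
  then have "f = var_binomial h k (\<lambda>j. part_prod (a j) (b j))"
    unfolding f(2) by (intro var_binomial_cong)
  moreover from this f(1) have
      "(var_binomial h k (\<lambda>j. unordered (a j)) :: ('v, 'k) cut_poly) \<in> cut_ideal G"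
      "(var_binomial h k (\<lambda>j. unordered (b j)) :: ('w, 'k) cut_poly) \<in> cut_ideal H"
    by (simp_all only: var_binomial_part_prod_in_cut_ideal_iff[OF factors])
  ultimately show "product_binomial G H h k f"
    using factors unfolding product_binomial_def var_binomial_def by blast
qed

lemma swap_binomial_in_cut_ideal:
  fixes f :: "('v + 'w, 'k::field) cut_poly"
  assumes "swap_binomial G H f"
  shows "f \<in> cut_ideal (disjoint_union G H)"
proof -
  obtain a b where "a \<in> ordered_partitions (verts G)" "b \<in> ordered_partitions (verts H)"
    and "f = var (part_prod a b) - var (part_prod a (prod.swap b))"
    using assms unfolding swap_binomial_def by blast
  then show ?thesis
    by (simp add: cut_ideal_disjoint_union_eq_toric_ideal[OF simple_G simple_H]
        toric_ideal_def cut_exponent_part_prod_swap[OF simple_G simple_H])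
qed

theorem binomial_in_cut_ideal_iff:
  fixes f :: "('v + 'w, 'k::field) cut_poly"
  assumes "f \<in> binomials (partitions (verts (disjoint_union G H)))"
  shows "f \<in> cut_ideal (disjoint_union G H) \<longleftrightarrow>
    swap_binomial G H f \<or> (\<exists>h k. product_binomial G H h k f)"
  using binomial_eq_var_binomial[OF assms] swap_binomial_in_cut_ideal
  unfolding product_binomial_iff by blast

lemma product_binomial_homogeneous:
  assumes "label_total (disjoint_union G H) c \<noteq> 0"
    and "product_binomial G H h k (f :: ('v + 'w, 'k::field) cut_poly)"
  shows "h = k"
  using assms(2)
    var_binomial_in_cut_ideal_homogeneous[OF simple_disjoint_union[OF simple_G simple_H] assms(1)]
  unfolding product_binomial_iff by blast

lemma product_binomial_zero: "product_binomial G H 1 1 (0 :: ('v + 'w, 'k::field) cut_poly)"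
proof -
  have "part_prod ({}, verts G) ({}, verts H) \<in> partitions (verts (disjoint_union G H))" by simp
  then show ?thesis
    unfolding product_binomial_iff
    by (auto simp: cut_ideal_disjoint_union_eq_toric_ideal[OF simple_G simple_H] toric_ideal_def
        var_binomial_def simp del: disjoint_union_simps)
qed

theorem homogeneous_binomial_in_cut_ideal_iff:
  fixes f :: "('v + 'w, 'k::field) cut_poly"
  assumes "label_total (disjoint_union G H) c \<noteq> 0"
    and "f \<in> binomials (partitions (verts (disjoint_union G H)))"
  shows "f \<in> cut_ideal (disjoint_union G H) \<longleftrightarrow>
    swap_binomial G H f \<or> (\<exists>h\<ge>1. product_binomial G H h h f)"
proof -
  have "\<exists>l\<ge>1. product_binomial G H l l f" if hk: "product_binomial G H h k f" for h k
  proof (cases "h = 0")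
    case True
    then have "f = 0"
      using hk product_binomial_homogeneous[OF assms(1) hk] by (simp add: product_binomial_def)
    then show ?thesis using product_binomial_zero by auto
  next
    case False
    then have "h \<ge> 1" by simp
    then show ?thesis
      using hk product_binomial_homogeneous[OF assms(1) hk] by blast
  qed
  then show ?thesis
    unfolding binomial_in_cut_ideal_iff[OF assms(2)] by blast
qed

end

theorem theorem3p1:
  fixes V :: "'u set" and E :: "'u set set"
    and G :: "('v, 'l) lmgraph" and H :: "('w, 'm) lmgraph"
  assumes "simple_graph V E"
    and "labelled_multigraph G" and "labelled_multigraph H"
  shows
    "(\<forall>n\<ge>1. (Aff (isolated n) :: ('k::field, _) module) \<cong>\<^sub>a point) \<and>

     (\<forall>\<sigma>. multiplicity_map E \<sigma> \<longrightarrow>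
        (Aff (classical V E) :: ('k, _) module) \<cong>\<^sub>a Aff (canonical V E \<sigma>) \<and>
        (cut_ideal (classical V E) :: ('u, 'k) cut_poly set) = cut_ideal (canonical V E \<sigma>)) \<and>

     (\<forall>x\<in>verts G. \<forall>y\<in>verts H.
        (Aff (disjoint_union G H) :: ('k, _) module) \<cong>\<^sub>a Aff (zero_sum x y G H)) \<and>

     (\<forall>a\<in>ordered_partitions (verts G). \<forall>b\<in>ordered_partitions (verts H).
        (cut_map (disjoint_union G H) (var (part_prod a b)) :: ('l + 'm, 'k) laurent) =
          relabel Inl (cut_map G (var (unordered a))) *
          relabel Inr (cut_map H (var (unordered b)))) \<and>

     (\<forall>n\<ge>1.
        (Aff (disjoint_union G (isolated n)) :: ('k, _) module) \<cong>\<^sub>a Aff G \<and>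
        (\<forall>ord. (\<forall>p\<in>partitions (verts G).
                  ord p \<in> ordered_partitions (verts G) \<and> unordered (ord p) = p) \<longrightarrow>
          (let R = cut_ring (disjoint_union G (isolated n)) :: ('v + nat, 'k) cut_poly ring;
               I' = Idl\<^bsub>R\<^esub> (extend_vars ord (verts (isolated n)) ` cut_ideal G)
           in \<exists>L J. L \<subseteq> carrier R \<and> (\<forall>f\<in>L. linear_form f) \<and> J = Idl\<^bsub>R\<^esub> L \<and>
                cut_ideal (disjoint_union G (isolated n)) = I' <+>\<^bsub>R\<^esub> J))) \<and>

     ((\<exists>c\<in>labels (disjoint_union G H). label_total (disjoint_union G H) c \<noteq> 0) \<longrightarrow>
        (\<forall>f \<in> binomials (partitions (verts (disjoint_union G H))) :: ('v + 'w, 'k) cut_poly set.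
           f \<in> cut_ideal (disjoint_union G H) \<longleftrightarrow>
             swap_binomial G H f \<or> (\<exists>h\<ge>1. product_binomial G H h h f))) \<and>
     ((\<forall>c\<in>labels (disjoint_union G H). label_total (disjoint_union G H) c = 0) \<longrightarrow>
        (\<forall>f \<in> binomials (partitions (verts (disjoint_union G H))) :: ('v + 'w, 'k) cut_poly set.
           f \<in> cut_ideal (disjoint_union G H) \<longleftrightarrow>
             swap_binomial G H f \<or> (\<exists>h k. product_binomial G H h k f)))"
proof -
  have simple_G: "simple G" and simple_H: "simple H"
    using assms(2,3) by (simp_all add: labelled_multigraph_def)
  note isolated = simple_isolated isolated_simps(2)
  show ?thesis
  proof (intro conjI allI ballI impI,
      goal_cases point Aff_multiplicity ideal_multiplicity zero_sum cut_map
        Aff_isolated ideal_isolated homogeneous inhomogeneous)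
    case point then show ?case by (intro Aff_edgeless_iso_point isolated)
  next
    case Aff_multiplicity with assms(1) show ?case by (rule Aff_canonical)
  next
    case ideal_multiplicity with assms(1) show ?case by (rule cut_ideal_canonical)
  next
    case zero_sum with simple_G simple_H show ?case by (rule Aff_zero_sum)
  next
    case cut_map from simple_G simple_H show ?case by (rule cut_map_disjoint_union)
  next
    case Aff_isolated then show ?case by (intro Aff_union_edgeless simple_G isolated)
  next
    case ideal_isolated
    then show ?case unfolding Let_def by (intro cut_ideal_union_edgeless simple_G isolated)
  next
    case homogeneous
    then show ?case using homogeneous_binomial_in_cut_ideal_iff[OF simple_G simple_H] by blast
  next
    case inhomogeneous then show ?case by (intro binomial_in_cut_ideal_iff simple_G simple_H)
  qed
qed

end
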